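(* Let $\ell>2$ and $n\ge1$ be integers. Consider a regular $\ell n$-gon inscribed in a circle, and divide the circle into $\ell$ equal arcs whose endpoints are not vertices of the polygon, each arc then containing $n$ vertices. Count the sets of chords joining pairs of vertices that satisfy all of the following: (1) the set is invariant under rotation by angle $2\pi/\ell$; (2) no two chords intersect and no two chords have a common endpoint; (3) no chord joins two vertices that are neighbouring vertices lying on the same arc. The number of such chord configurations equals $a_{n,n}$.
   Context: For nonnegative integers $p,q$, $a_{p,q}$ denotes the number of ways to partition a set consisting of $p$ marked points on a line and $q$ marked points on a parallel line into pairs, joining the two points of each pair by a straight segment, such that no two segments have a common point (in particular, no endpoint lies on another segment). *)

theory Defs
  imports "HOL-Analysis.Analysis" "HOL-Library.Disjoint_Sets"
begin

text \<open>A segment (or chord) is represented by the two-element set \<open>e\<close> of its endpoints; the segment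
  itself is the point set \<open>convex hull e\<close>, endpoints included. Disjointness of these closed segments
  therefore also excludes common endpoints and endpoints in the interior of another segment.\<close>

definition disjoint_segments :: "complex set set \<Rightarrow> bool" where
  "disjoint_segments M \<longleftrightarrow> pairwise (\<lambda>e f. convex hull e \<inter> convex hull f = {}) M"

text \<open>The count below does not depend on the positions of the marked points on the two lines nor
  on the lines; we use integer positions on the lines \<open>Im z = 0\<close> and \<open>Im z = 1\<close>.\<close>

definition marked_points :: "nat \<Rightarrow> nat \<Rightarrow> complex set" where
  "marked_points p q =
     (\<lambda>i. Complex (real i) 0) ` {..<p} \<union> (\<lambda>j. Complex (real j) 1) ` {..<q}"

definition num_pairings :: "nat \<Rightarrow> nat \<Rightarrow> nat" where
  "num_pairings p q = card {M. partition_on (marked_points p q) M \<and> (\<forall>e\<in>M. card e = 2) \<and>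
                    disjoint_segments M}"

definition circle_point :: "complex \<Rightarrow> real \<Rightarrow> real \<Rightarrow> complex" where
  "circle_point c r t = c + of_real r * cis t"

text \<open>The index \<open>k\<close> of a vertex is cyclic: indices that agree modulo \<open>m\<close> give the same vertex.\<close>

definition vertex :: "complex \<Rightarrow> real \<Rightarrow> real \<Rightarrow> nat \<Rightarrow> nat \<Rightarrow> complex" where
  "vertex c r \<phi> m k = circle_point c r (\<phi> + 2 * pi * real k / real m)"

definition vertices :: "complex \<Rightarrow> real \<Rightarrow> real \<Rightarrow> nat \<Rightarrow> complex set" where
  "vertices c r \<phi> m = vertex c r \<phi> m ` {..<m}"

definition neighbouring :: "complex \<Rightarrow> real \<Rightarrow> real \<Rightarrow> nat \<Rightarrow> complex set \<Rightarrow> bool" where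
  "neighbouring c r \<phi> m e \<longleftrightarrow> (\<exists>k<m. e = {vertex c r \<phi> m k, vertex c r \<phi> m (Suc k)})"

definition arc_endpoint :: "complex \<Rightarrow> real \<Rightarrow> real \<Rightarrow> nat \<Rightarrow> nat \<Rightarrow> complex" where
  "arc_endpoint c r \<theta> l j = circle_point c r (\<theta> + 2 * pi * real j / real l)"

definition circle_arc :: "complex \<Rightarrow> real \<Rightarrow> real \<Rightarrow> nat \<Rightarrow> nat \<Rightarrow> complex set" where
  "circle_arc c r \<theta> l j =
     circle_point c r ` {\<theta> + 2 * pi * real j / real l .. \<theta> + 2 * pi * real (Suc j) / real l}"

definition rotation :: "complex \<Rightarrow> real \<Rightarrow> complex \<Rightarrow> complex" where
  "rotation c t z = c + cis t * (z - c)"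

definition chord_configurations ::
  "complex \<Rightarrow> real \<Rightarrow> real \<Rightarrow> real \<Rightarrow> nat \<Rightarrow> nat \<Rightarrow> complex set set set" where
  "chord_configurations c r \<phi> \<theta> l n =
     {M. (\<forall>e\<in>M. e \<subseteq> vertices c r \<phi> (l * n) \<and> card e = 2) \<and>
         (\<lambda>e. rotation c (2 * pi / real l) ` e) ` M = M \<and>
         disjoint_segments M \<and>
         (\<forall>e\<in>M. \<not> (neighbouring c r \<phi> (l * n) e \<and> (\<exists>j<l. e \<subseteq> circle_arc c r \<theta> l j)))}"

end

theory Submission
  imports Defs
begin

text \<open>Number the vertices by the integers modulo \<open>l * n\<close>, starting with the first vertex of an arc.
  Since \<open>l > 2\<close>, a chord of an invariant configuration spans fewer than \<open>n\<close> steps on its shorter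
  side, as otherwise it would meet its own rotated copy. Hence a configuration is the same as an
  \<open>n\<close>-periodic noncrossing system of arcs over the integers. Such a system is determined by the
  types of \<open>n\<close> consecutive integers (left end, right end, free), and every word with as many left ends as
  right ends occurs. Condition (3) says that no left end is immediately followed by a
  right end inside the word, so between two free letters all right ends precede all left ends.
  The right ends and free letters on the one hand, and the left ends and free letters on the other
  hand, are then arbitrary sequences with equal numbers of free letters. Replacing every end by a
  horizontal segment between two neighbouring points, and every free letter by a single point, they
  describe the two rows of a pairing; the single points are joined across in order.\<close>

subsection \<open>Words and domino tilings\<close>

text \<open>The vertices of a circle carry no left and right, so left and right ends make sense only
  after unrolling the circle to the integers, one turn being \<open>l * n\<close> steps. Spans below
  \<open>n\<close> fix the orientation: since \<open>2 * n < l * n\<close>, a chord has only one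
  lift of such a span, up to full turns. For \<open>l = 2\<close> a diameter would be its own
  rotated copy, so spans below \<open>n\<close> could not be enforced. After unrolling,
  \<open>l\<close> has disappeared, which is why the count does not depend on it. Arcs may run past
  a block of \<open>n\<close> integers, so left and right ends are matched only modulo
  \<open>n\<close>, and rebuilding the arcs from a word takes a periodic height path; equal numbers
  of both ends are exactly what makes that path close up. Both counts become the sum over
  \<open>s\<close> of the squared number of ways to place \<open>s\<close> dominoes in a row of
  \<open>n\<close> cells. On the pairing side, disjointness forces each segment within a row to join
  neighbours and the remaining points to be joined in order.\<close>

text \<open>\<open>Op\<close> and \<open>Cl\<close> mark the left and right ends of arcs, \<open>Dot\<close> the integers on no arc.\<close>

datatype letter = Op | Cl | Dot

abbreviation no_op_cl :: "letter list \<Rightarrow> bool" where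
  "no_op_cl \<equiv> successively (\<lambda>a b. \<not> (a = Op \<and> b = Cl))"

definition words :: "nat \<Rightarrow> letter list set" where
  "words n = {w. length w = n \<and> count_list w Op = count_list w Cl \<and> no_op_cl w}"

text \<open>Between two common single cells all \<open>Cl\<close> are emitted before all
  \<open>Op\<close>. The two clauses that drop a remaining \<open>False\<close> are reached only if
  the lists differ in their number of \<open>False\<close>, since each \<open>Dot\<close> consumes
  one from both.\<close>

fun merge :: "bool list \<Rightarrow> bool list \<Rightarrow> letter list" where
  "merge (True # u) v = Cl # merge u v"
| "merge (False # u) (True # v) = Op # merge (False # u) v"
| "merge [] (True # v) = Op # merge [] v"
| "merge (False # u) (False # v) = Dot # merge u v"
| "merge (False # u) [] = []"
| "merge [] (False # v) = []"
| "merge [] [] = []"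

definition cl_part :: "letter list \<Rightarrow> bool list" where
  "cl_part w = map (\<lambda>a. a = Cl) (filter (\<lambda>a. a \<noteq> Op) w)"

definition op_part :: "letter list \<Rightarrow> bool list" where
  "op_part w = map (\<lambda>a. a = Op) (filter (\<lambda>a. a \<noteq> Cl) w)"

lemma parts_merge:
  assumes "count_list u False = count_list v False"
  shows "cl_part (merge u v) = u \<and> op_part (merge u v) = v"
  using assms by (induction u v rule: merge.induct) (auto simp: cl_part_def op_part_def)

text \<open>Right after emitting an \<open>Op\<close>, the first list is empty or begins with
  \<open>False\<close>, so this is what keeps a \<open>Cl\<close> from following an
  \<open>Op\<close>.\<close>

lemma hd_merge:
  assumes "merge u v = a # w" "u = [] \<or> \<not> hd u"
  shows "a \<noteq> Cl"
  using assms by (cases "(u, v)" rule: merge.cases) auto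

lemma no_op_cl_merge: "no_op_cl (merge u v)"
proof (induction u v rule: merge.induct)
  case (2 u v)
  then show ?case
    using hd_merge[of "False # u" v] by (cases "merge (False # u) v") auto
next
  case (3 v)
  then show ?case
    using hd_merge[of "[]" v] by (cases "merge [] v") auto
qed (auto simp: successively_Cons)

text \<open>The run of \<open>Op\<close> after the first one is deleted by \<open>cl_part\<close>,
  and whatever ends this run is not a \<open>Cl\<close>. Hence \<open>merge\<close> is sent to the
  clause that emits the \<open>Op\<close> again.\<close>

lemma hd_cl_part:
  assumes "no_op_cl (Op # w)"
  shows "cl_part w = [] \<or> \<not> hd (cl_part w)"
  using assms
proof (induction w)
  case (Cons a w)
  then show ?case by (cases a) (auto simp: cl_part_def)
qed (simp add: cl_part_def)

lemma merge_parts: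
  assumes "no_op_cl w"
  shows "merge (cl_part w) (op_part w) = w"
  using assms
proof (induction w)
  case Nil
  then show ?case by (simp add: cl_part_def op_part_def)
next
  case (Cons a w)
  then have IH: "merge (cl_part w) (op_part w) = w"
    by (cases w) (auto simp: cl_part_def op_part_def)
  show ?case
  proof (cases a)
    case Op
    then have "cl_part w = [] \<or> \<not> hd (cl_part w)"
      using Cons.prems hd_cl_part by blast
    then have "merge (cl_part w) (True # op_part w) = Op # merge (cl_part w) (op_part w)"
      by (cases "cl_part w") auto
    then show ?thesis using IH Op by (simp add: cl_part_def op_part_def)
  qed (use IH in \<open>auto simp: cl_part_def op_part_def\<close>)
qed

text \<open>\<open>True\<close> is a domino, \<open>False\<close> a single cell.\<close>

definition tilings :: "nat \<Rightarrow> nat \<Rightarrow> bool list set" where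
  "tilings n s = {u. count_list u False + 2 * s = n \<and> count_list u True = s}"

lemma count_list_parts:
  "count_list (cl_part w) False = count_list w Dot"
  "count_list (op_part w) False = count_list w Dot"
  "count_list (cl_part w) True = count_list w Cl"
  "count_list (op_part w) True = count_list w Op"
proof -
  have "count_list (cl_part w) False = count_list w Dot \<and>
    count_list (op_part w) False = count_list w Dot \<and>
    count_list (cl_part w) True = count_list w Cl \<and>
    count_list (op_part w) True = count_list w Op"
  proof (induction w)
    case (Cons a w)
    then show ?case by (cases a) (auto simp: cl_part_def op_part_def)
  qed (simp add: cl_part_def op_part_def)
  then show "count_list (cl_part w) False = count_list w Dot"
    "count_list (op_part w) False = count_list w Dot"
    "count_list (cl_part w) True = count_list w Cl"
    "count_list (op_part w) True = count_list w Op" by auto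
qed

lemma length_word: "length w = count_list w Dot + count_list w Op + count_list w Cl"
proof (induction w)
  case (Cons a w)
  then show ?case by (cases a) auto
qed simp

text \<open>The index \<open>s\<close> is the common number of \<open>Op\<close> and
  \<open>Cl\<close>. With \<open>n - 2 * s\<close> letters \<open>Dot\<close>, kept as single cells
  in both parts, each part has total width \<open>n\<close>.\<close>

lemma bij_betw_words_tilings:
  "bij_betw (\<lambda>w. (cl_part w, op_part w)) (words n) (\<Union>s. tilings n s \<times> tilings n s)"
proof (rule bij_betw_byWitness[where f' = "\<lambda>(u, v). merge u v"])
  show "\<forall>w\<in>words n. (\<lambda>(u, v). merge u v) (cl_part w, op_part w) = w"
    by (simp add: words_def merge_parts)
  have eq: "count_list u False = count_list v False" if "u \<in> tilings n s" "v \<in> tilings n s" for u v s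
    using that by (simp add: tilings_def)
  show "\<forall>p\<in>\<Union>s. tilings n s \<times> tilings n s.
      (cl_part ((\<lambda>(u, v). merge u v) p), op_part ((\<lambda>(u, v). merge u v) p)) = p"
  proof
    fix p assume "p \<in> (\<Union>s. tilings n s \<times> tilings n s)"
    then obtain u v s where "p = (u, v)" "u \<in> tilings n s" "v \<in> tilings n s" by auto
    then show "(cl_part ((\<lambda>(u, v). merge u v) p), op_part ((\<lambda>(u, v). merge u v) p)) = p"
      using parts_merge[OF eq] by simp
  qed
  show "(\<lambda>w. (cl_part w, op_part w)) ` words n \<subseteq> (\<Union>s. tilings n s \<times> tilings n s)"
    using length_word by (auto simp: words_def tilings_def count_list_parts)
  show "(\<lambda>(u, v). merge u v) ` (\<Union>s. tilings n s \<times> tilings n s) \<subseteq> words n"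
  proof
    fix w' assume "w' \<in> (\<lambda>(u, v). merge u v) ` (\<Union>s. tilings n s \<times> tilings n s)"
    then obtain u v s where w': "w' = merge u v" and uv: "u \<in> tilings n s" "v \<in> tilings n s"
      by auto
    define w where "w = merge u v"
    have "cl_part w = u" "op_part w = v"
      using parts_merge eq[OF uv] by (auto simp: w_def)
    then show "w' \<in> words n"
      using uv length_word[of w] count_list_parts[of w] no_op_cl_merge[of u v]
      by (auto simp: words_def tilings_def w_def w')
  qed
qed

text \<open>A spaced set is the set of left ends of disjoint dominoes in \<open>{..<n}\<close>.\<close>

definition spaced :: "nat \<Rightarrow> nat set \<Rightarrow> bool" where
  "spaced n B \<longleftrightarrow> (\<forall>i\<in>B. Suc i < n \<and> Suc i \<notin> B)"

fun starts :: "bool list \<Rightarrow> nat set" where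
  "starts [] = {}"
| "starts (False # u) = Suc ` starts u"
| "starts (True # u) = insert 0 ((\<lambda>i. i + 2) ` starts u)"

lemma finite_starts [simp]: "finite (starts u)"
  by (induction u rule: starts.induct) auto

lemma card_starts: "card (starts u) = count_list u True"
  by (induction u rule: starts.induct) (auto simp: card_image card_insert_if inj_on_def)

lemma spaced_starts: "spaced (count_list u False + 2 * count_list u True) (starts u)"
  by (induction u rule: starts.induct) (auto simp: spaced_def)

text \<open>Single cells after the last domino leave no trace in \<open>starts\<close>; equal total
  widths make up for that.\<close>

lemma starts_inj:
  assumes "starts u = starts v"
    and "count_list u False + 2 * count_list u True = count_list v False + 2 * count_list v True"
  shows "u = v"
  using assms
proof (induction u arbitrary: v rule: starts.induct)
  case 1
  then show ?case by (cases v rule: starts.cases) auto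
next
  case (2 u)
  then show ?case by (cases v rule: starts.cases) (auto simp: inj_image_eq_iff)
next
  case (3 u)
  show ?case
  proof (cases v rule: starts.cases)
    case (3 u')
    have eq: "insert 0 ((\<lambda>i. i + 2) ` starts u) = insert 0 ((\<lambda>i. i + 2) ` starts u')"
      using "3.prems" 3 by simp
    have "(\<lambda>i. i + 2) ` starts u = (\<lambda>i. i + 2) ` starts u'"
      using arg_cong[OF eq, of "\<lambda>X. X - {0}"] by auto
    then have "starts u = starts u'"
      by (subst (asm) inj_image_eq_iff) (auto simp: inj_def)
    then show ?thesis using "3.IH"[of u'] "3.prems" 3 by simp
  qed (use "3.prems" in auto)
qed

text \<open>The tiling is read off from cell 0: a domino if \<open>0 \<in> B\<close>, otherwise a
  single cell. In the first case two cells are removed, and \<open>spaced\<close> guarantees that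
  cell 1 exists and starts no domino.\<close>

lemma starts_surj:
  assumes "spaced n B"
  shows "\<exists>u. starts u = B \<and> count_list u False + 2 * count_list u True = n"
  using assms
proof (induction n arbitrary: B rule: less_induct)
  case (less n)
  show ?case
  proof (cases "0 \<in> B")
    case True
    then have n: "2 \<le> n" using less.prems by (auto simp: spaced_def)
    have "1 \<notin> B" using True less.prems by (auto simp: spaced_def)
    have "spaced (n - 2) {i. i + 2 \<in> B}"
      using less.prems by (fastforce simp: spaced_def)
    then obtain u where u: "starts u = {i. i + 2 \<in> B}"
      "count_list u False + 2 * count_list u True = n - 2"
      using less.IH[of "n - 2"] n by auto
    have "starts (True # u) = B"
    proof (intro set_eqI)
      fix i
      show "i \<in> starts (True # u) \<longleftrightarrow> i \<in> B"
        using True \<open>1 \<notin> B\<close> u(1) by (cases i rule: nat.exhaust; cases "i - 1") (auto simp: image_iff)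
    qed
    then show ?thesis using u(2) n by (intro exI[of _ "True # u"]) auto
  next
    case False
    show ?thesis
    proof (cases "n = 0")
      case True
      then show ?thesis using less.prems by (intro exI[of _ "[]"]) (auto simp: spaced_def)
    next
      case n: False
      have "spaced (n - 1) {i. Suc i \<in> B}"
        using less.prems by (fastforce simp: spaced_def)
      then obtain u where u: "starts u = {i. Suc i \<in> B}"
        "count_list u False + 2 * count_list u True = n - 1"
        using less.IH[of "n - 1"] n by auto
      have "starts (False # u) = B"
      proof (intro set_eqI)
        fix i
        show "i \<in> starts (False # u) \<longleftrightarrow> i \<in> B"
          using False u(1) by (cases i) (auto simp: image_iff)
      qed
      then show ?thesis using u(2) n by (intro exI[of _ "False # u"]) auto
    qed
  qed
qed

text \<open>The normal form in which chord configurations and pairings are compared.\<close>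

definition domino_pairs :: "nat \<Rightarrow> (nat set \<times> nat set) set" where
  "domino_pairs n = {(B, T). spaced n B \<and> spaced n T \<and> card B = card T}"

lemma bij_betw_tilings_dominoes:
  "bij_betw (map_prod starts starts) (\<Union>s. tilings n s \<times> tilings n s) (domino_pairs n)"
  unfolding bij_betw_def
proof
  show "inj_on (map_prod starts starts) (\<Union>s. tilings n s \<times> tilings n s)"
    by (rule inj_onI) (auto simp: tilings_def intro!: starts_inj)
  show "map_prod starts starts ` (\<Union>s. tilings n s \<times> tilings n s) = domino_pairs n"
  proof (intro equalityI subsetI)
    fix p assume "p \<in> map_prod starts starts ` (\<Union>s. tilings n s \<times> tilings n s)"
    then obtain u v s where "p = (starts u, starts v)" "u \<in> tilings n s" "v \<in> tilings n s"
      by auto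
    then show "p \<in> domino_pairs n"
      using spaced_starts[of u] spaced_starts[of v] by (auto simp: domino_pairs_def tilings_def card_starts)
  next
    fix p assume "p \<in> domino_pairs n"
    then obtain B T where p: "p = (B, T)" "spaced n B" "spaced n T" "card B = card T"
      by (auto simp: domino_pairs_def)
    obtain u v where uv: "starts u = B" "count_list u False + 2 * count_list u True = n"
      "starts v = T" "count_list v False + 2 * count_list v True = n"
      using starts_surj p by metis
    then have "count_list u True = count_list v True"
      using p card_starts by metis
    then have "(u, v) \<in> (\<Union>s. tilings n s \<times> tilings n s)"
      using uv by (auto simp: tilings_def)
    then show "p \<in> map_prod starts starts ` (\<Union>s. tilings n s \<times> tilings n s)"
      using uv p by (intro image_eqI[of _ _ "(u, v)"]) auto
  qed
qed

lemma card_words: "card (words n) = card (domino_pairs n)"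
  using bij_betw_same_card[OF bij_betw_words_tilings] bij_betw_same_card[OF bij_betw_tilings_dominoes]
  by simp

subsection \<open>Periodic arc systems and words\<close>

text \<open>Stated for a relation because partners are known only through existence statements, such
  as an arc found up to a shift by a multiple of \<open>n\<close>.\<close>

lemma card_eq_if_matching:
  assumes "\<And>a. a \<in> X \<Longrightarrow> \<exists>b\<in>Y. R a b" "\<And>b. b \<in> Y \<Longrightarrow> \<exists>a\<in>X. R a b"
    and "\<And>a b b'. \<lbrakk>a \<in> X; b \<in> Y; b' \<in> Y; R a b; R a b'\<rbrakk> \<Longrightarrow> b = b'"
    and "\<And>a a' b. \<lbrakk>a \<in> X; a' \<in> X; b \<in> Y; R a b; R a' b\<rbrakk> \<Longrightarrow> a = a'"
  shows "card X = card Y"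
proof -
  obtain f where f: "\<And>a. a \<in> X \<Longrightarrow> f a \<in> Y \<and> R a (f a)"
    using assms(1) by metis
  have "inj_on f X" using f assms(4) by (metis inj_onI)
  moreover have "f ` X = Y"
  proof
    show "f ` X \<subseteq> Y" using f by auto
    show "Y \<subseteq> f ` X" using f assms(2,3) by blast
  qed
  ultimately show ?thesis by (metis card_image)
qed

text \<open>The last condition excludes both crossing arcs and arcs with a common end.\<close>

definition arc_systems :: "int \<Rightarrow> (int \<times> int) set set" where
  "arc_systems n = {A. (\<forall>(x, y)\<in>A. x < y) \<and>
     (\<forall>x y. (x + n, y + n) \<in> A \<longleftrightarrow> (x, y) \<in> A) \<and>
     (\<forall>x y x' y'. (x, y) \<in> A \<longrightarrow> (x', y') \<in> A \<longrightarrow> x \<le> x' \<longrightarrow> x' \<le> y \<longrightarrow> y \<le> y' \<longrightarrow> x = x' \<and> y = y')}"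

lemma arc_less: "A \<in> arc_systems n \<Longrightarrow> (x, y) \<in> A \<Longrightarrow> x < y"
  by (auto simp: arc_systems_def)

lemma arc_nested:
  assumes "A \<in> arc_systems n" "(x, y) \<in> A" "(x', y') \<in> A" "x \<le> x'" "x' \<le> y" "y \<le> y'"
  shows "x = x' \<and> y = y'"
  using assms unfolding arc_systems_def by blast

lemma arc_shift1: "A \<in> arc_systems n \<Longrightarrow> (x + n, y + n) \<in> A \<longleftrightarrow> (x, y) \<in> A"
  by (auto simp: arc_systems_def)

lemma arc_shift:
  assumes "A \<in> arc_systems n"
  shows "(x + k * n, y + k * n) \<in> A \<longleftrightarrow> (x, y) \<in> A"
proof (induction k rule: int_induct[where k = 0])
  case (step1 i)
  then show ?case
    using arc_shift1[OF assms, of "x + i * n" "y + i * n"] by (simp add: algebra_simps)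
next
  case (step2 i)
  then show ?case
    using arc_shift1[OF assms, of "x + (i - 1) * n" "y + (i - 1) * n"] by (simp add: algebra_simps)
qed simp

text \<open>An arc with \<open>x + n \<le> y\<close> would cross or touch its own translate by
  \<open>n\<close>.\<close>

lemma arc_short:
  assumes "A \<in> arc_systems n" "(x, y) \<in> A" "n > 0"
  shows "y < x + n"
  using arc_nested[OF assms(1,2), of "x + n" "y + n"] arc_shift1[OF assms(1)] assms by force

lemma arc_left_unique:
  assumes "A \<in> arc_systems n" "(x, y) \<in> A" "(x, y') \<in> A"
  shows "y = y'"
  using arc_nested[OF assms(1-3)] arc_nested[OF assms(1,3,2)] arc_less[OF assms(1)] assms
  by (metis less_imp_le linear order_refl)

lemma arc_right_unique:
  assumes "A \<in> arc_systems n" "(x, y) \<in> A" "(x', y) \<in> A"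
  shows "x = x'"
  using arc_nested[OF assms(1-3)] arc_nested[OF assms(1,3,2)] arc_less[OF assms(1)] assms
  by (metis less_imp_le linear order_refl)

lemma arc_not_both:
  assumes "A \<in> arc_systems n" "(x, y) \<in> A" "(y, z) \<in> A"
  shows False
  using arc_nested[OF assms] arc_less[OF assms(1)] assms by force

definition arc_word :: "nat \<Rightarrow> (int \<times> int) set \<Rightarrow> letter list" where
  "arc_word n A = map (\<lambda>i. if \<exists>y. (int i, y) \<in> A then Op else if \<exists>y. (y, int i) \<in> A then Cl else Dot) [0..<n]"

lemma arc_word_Op:
  assumes "A \<in> arc_systems (int n)" "n > 0"
  shows "arc_word n A ! nat (x mod int n) = Op \<longleftrightarrow> (\<exists>y. (x, y) \<in> A)"
proof -
  define k where "k = x div int n"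
  have x: "x = x mod int n + k * int n" by (simp add: k_def)
  have "(\<exists>y. (x, y) \<in> A) \<longleftrightarrow> (\<exists>y. (x mod int n, y) \<in> A)"
    using arc_shift[OF assms(1), of "x mod int n" k] x by (metis diff_add_cancel)
  moreover have "nat (x mod int n) < n" using assms(2) by (simp add: nat_less_iff)
  ultimately show ?thesis using assms(2) by (auto simp: arc_word_def)
qed

lemma arc_word_Cl:
  assumes "A \<in> arc_systems (int n)" "n > 0"
  shows "arc_word n A ! nat (x mod int n) = Cl \<longleftrightarrow> (\<exists>y. (y, x) \<in> A)"
proof -
  define k where "k = x div int n"
  have x: "x = x mod int n + k * int n" by (simp add: k_def)
  have "(\<exists>y. (y, x) \<in> A) \<longleftrightarrow> (\<exists>y. (y, x mod int n) \<in> A)"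
    using arc_shift[OF assms(1), of _ k "x mod int n"] x by (metis diff_add_cancel)
  moreover have "nat (x mod int n) < n" using assms(2) by (simp add: nat_less_iff)
  ultimately show ?thesis using assms(2) arc_not_both[OF assms(1)] by (auto simp: arc_word_def)
qed

text \<open>Two arcs sharing a left end but not the right one would yield a shorter arc with the same defect.\<close>

lemma arc_subset_if_ends_eq:
  assumes "A \<in> arc_systems n" "A' \<in> arc_systems n"
    and "\<And>x. (\<exists>y. (x, y) \<in> A) \<longleftrightarrow> (\<exists>y. (x, y) \<in> A')"
    and "\<And>y. (\<exists>x. (x, y) \<in> A) \<longleftrightarrow> (\<exists>x. (x, y) \<in> A')"
    and "(x, y) \<in> A"
  shows "(x, y) \<in> A'"
  using assms
proof (induction "nat (y - x)" arbitrary: x y A A' rule: less_induct)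
  case less
  note A = less.prems(1) and A' = less.prems(2) and xy = less.prems(5)
  \<comment> \<open>The induction runs over both systems, so the hypothesis is used with their roles
    exchanged: shorter arcs of \<open>A'\<close> lie in \<open>A\<close>.\<close>
  have IH: "(a, b) \<in> A" if "(a, b) \<in> A'" "b - a < y - x" for a b
    using less.hyps[OF _ A' A _ _ that(1)] less.prems(3,4) that arc_less[OF A xy] by auto
  obtain y' where y': "(x, y') \<in> A'" using less.prems(3) xy by blast
  obtain z where z: "(z, y) \<in> A'" using less.prems(4) xy by blast
  consider "y' < y" | "y' = y" | "y < y'" by linarith
  then show ?case
  proof cases
    case 1
    then show ?thesis using IH[OF y'] arc_left_unique[OF A xy] by force
  next
    case 2
    then show ?thesis using y' by simp
  next
    case 3
    \<comment> \<open>With \<open>z \<le> x\<close> the arcs \<open>(z, y)\<close> and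
      \<open>(x, y')\<close> of \<open>A'\<close> would cross or share their left end. So
      \<open>(z, y)\<close> is shorter than \<open>(x, y)\<close> and passes to \<open>A\<close>,
      where two arcs then end at \<open>y\<close>.\<close>
    then have "x < z"
      using arc_nested[OF A' z y'] arc_less[OF A xy] by force
    then have "(z, y) \<in> A" using IH[OF z] by auto
    then show ?thesis using arc_right_unique[OF A xy] \<open>x < z\<close> by force
  qed
qed

lemma inj_on_arc_word:
  assumes "n > 0"
  shows "inj_on (arc_word n) (arc_systems (int n))"
proof (rule inj_onI)
  fix A A' assume A: "A \<in> arc_systems (int n)" and A': "A' \<in> arc_systems (int n)"
    and eq: "arc_word n A = arc_word n A'"
  have 1: "(\<exists>y. (x, y) \<in> A) \<longleftrightarrow> (\<exists>y. (x, y) \<in> A')" for x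
    using arc_word_Op[OF A assms] arc_word_Op[OF A' assms] eq by metis
  have 2: "(\<exists>x. (x, y) \<in> A) \<longleftrightarrow> (\<exists>x. (x, y) \<in> A')" for y
    using arc_word_Cl[OF A assms] arc_word_Cl[OF A' assms] eq by metis
  show "A = A'"
    using arc_subset_if_ends_eq[OF A A' 1 2] arc_subset_if_ends_eq[OF A' A 1[symmetric] 2[symmetric]]
    by auto
qed

text \<open>The residue \<open>n - 1\<close> is the last position of a block; there \<open>x\<close>
  and \<open>x + 1\<close> belong to different arcs of the circle, so the chord between them is
  allowed.\<close>

definition split_arcs :: "int \<Rightarrow> (int \<times> int) set set" where
  "split_arcs n = {A \<in> arc_systems n. \<forall>x. (x, x + 1) \<in> A \<longrightarrow> x mod n = n - 1}"

lemma count_list_nth: "count_list w a = card {i. i < length w \<and> w ! i = a}"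
  by (simp add: count_list_eq_length_filter length_filter_conv_card eq_commute)

lemma arc_word_in_words:
  assumes "A \<in> split_arcs (int n)" "n > 0"
  shows "arc_word n A \<in> words n"
proof -
  let ?w = "arc_word n A"
  have A: "A \<in> arc_systems (int n)" using assms by (simp add: split_arcs_def)
  have len: "length ?w = n" by (simp add: arc_word_def)
  have op: "?w ! i = Op \<longleftrightarrow> (\<exists>y. (int i, y) \<in> A)" if "i < n" for i
    using arc_word_Op[OF A assms(2), of "int i"] that by simp
  have cl: "?w ! i = Cl \<longleftrightarrow> (\<exists>x. (x, int i) \<in> A)" if "i < n" for i
    using arc_word_Cl[OF A assms(2), of "int i"] that by simp
  have "card {i. i < n \<and> ?w ! i = Op} = card {i. i < n \<and> ?w ! i = Cl}"
  \<comment> \<open>An arc that starts in the window may end in a later block. The multiple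
    \<open>k\<close> of the period brings its right end back into the window.\<close>
  proof (rule card_eq_if_matching[where R = "\<lambda>i j. \<exists>k. (int i, int j + k * int n) \<in> A"])
    fix i assume "i \<in> {i. i < n \<and> ?w ! i = Op}"
    then obtain y where y: "(int i, y) \<in> A" using op by auto
    define j where "j = nat (y mod int n)"
    have j: "j < n" "int j = y mod int n" using assms(2) by (simp_all add: j_def nat_less_iff)
    have yj: "y = int j + (y div int n) * int n" using j by simp
    have "?w ! j = Cl" using y arc_word_Cl[OF A assms(2), of y] by (auto simp: j_def)
    moreover have "(int i, int j + (y div int n) * int n) \<in> A"
      using y by (simp only: yj[symmetric])
    ultimately show "\<exists>j\<in>{i. i < n \<and> ?w ! i = Cl}. \<exists>k. (int i, int j + k * int n) \<in> A"
      using j(1) by blast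
  next
    fix j assume "j \<in> {i. i < n \<and> ?w ! i = Cl}"
    then obtain x where x: "(x, int j) \<in> A" using cl by auto
    define i where "i = nat (x mod int n)"
    have i: "i < n" "int i = x mod int n" using assms(2) by (simp_all add: i_def nat_less_iff)
    have "?w ! i = Op" using x arc_word_Op[OF A assms(2), of x] by (auto simp: i_def)
    moreover have "x + - (x div int n) * int n = int i" using i by (simp add: minus_div_mult_eq_mod)
    then have "(int i, int j + (- (x div int n)) * int n) \<in> A"
      using x arc_shift[OF A, of x "- (x div int n)" "int j"] by (simp only: )
    ultimately show "\<exists>i\<in>{i. i < n \<and> ?w ! i = Op}. \<exists>k. (int i, int j + k * int n) \<in> A"
      using i(1) by blast
  next
    fix i j j' assume "j \<in> {i. i < n \<and> ?w ! i = Cl}" "j' \<in> {i. i < n \<and> ?w ! i = Cl}"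
      and "\<exists>k. (int i, int j + k * int n) \<in> A" "\<exists>k. (int i, int j' + k * int n) \<in> A"
    then obtain k k' where "int j + k * int n = int j' + k' * int n" "j < n" "j' < n"
      using arc_left_unique[OF A] by blast
    then show "j = j'"
      by (metis mod_mult_self1 mod_less of_nat_eq_iff zmod_int)
  next
    fix i i' j assume "i \<in> {i. i < n \<and> ?w ! i = Op}" "i' \<in> {i. i < n \<and> ?w ! i = Op}"
      and "\<exists>k. (int i, int j + k * int n) \<in> A" "\<exists>k. (int i', int j + k * int n) \<in> A"
    then obtain k k' where k: "(int i, int j + k * int n) \<in> A" "(int i', int j + k' * int n) \<in> A"
      "i < n" "i' < n" by auto
    then have "(int i - k * int n, int j) \<in> A" "(int i' - k' * int n, int j) \<in> A"
      using arc_shift[OF A, of "int i" "-k" "int j + k * int n"]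
        arc_shift[OF A, of "int i'" "-k'" "int j + k' * int n"] by simp_all
    then have "int i - k * int n = int i' - k' * int n" using arc_right_unique[OF A] by blast
    then have "int i + (-k) * int n = int i' + (-k') * int n" by simp
    then show "i = i'" using k(3,4)
      by (metis mod_mult_self1 mod_less of_nat_eq_iff zmod_int)
  qed
  then have "count_list ?w Op = count_list ?w Cl" by (simp add: count_list_nth len)
  moreover have "no_op_cl ?w"
  proof (clarsimp simp: successively_conv_nth len)
    fix i assume i: "Suc i < n" "?w ! i = Op" "?w ! Suc i = Cl"
    obtain y where y: "(int i, y) \<in> A" using i op by auto
    obtain x where x: "(x, int i + 1) \<in> A" using i cl[of "Suc i"] by (auto simp: add.commute)
    \<comment> \<open>The arc ending at \<open>i + 1\<close> starts at or before \<open>i\<close>,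
      and the arc starting at \<open>i\<close> ends at or after \<open>i + 1\<close>, so they can
      only be the same arc.\<close>
    have "x = int i" "y = int i + 1"
      using arc_nested[OF A x y] arc_less[OF A x] arc_less[OF A y] by auto
    then have "int i mod int n = int n - 1" using assms y by (auto simp: split_arcs_def)
    then show False using i by auto
  qed
  ultimately show ?thesis by (simp add: words_def len)
qed

section \<open>The height path of a word and the arcs it determines\<close>

definition letter_val :: "letter \<Rightarrow> int" where
  "letter_val a = (case a of Op \<Rightarrow> 1 | Cl \<Rightarrow> -1 | Dot \<Rightarrow> 0)"

definition letter_at :: "letter list \<Rightarrow> int \<Rightarrow> letter" where
  "letter_at w x = w ! nat (x mod int (length w))"

text \<open>The lattice path of the repeated word, with its value taken before the letter at
  \<open>x\<close>. It is periodic by construction; that it also follows the letters across the end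
  of the word (\<open>height_step\<close>) is due to the total sum 0 of a balanced word.\<close>

definition height :: "letter list \<Rightarrow> int \<Rightarrow> int" where
  "height w x = sum_list (map letter_val (take (nat (x mod int (length w))) w))"

lemma sum_list_letter_val:
  "sum_list (map letter_val w) = int (count_list w Op) - int (count_list w Cl)"
proof (induction w)
  case (Cons a w)
  then show ?case by (cases a) (auto simp: letter_val_def)
qed simp

lemma height_step:
  assumes "count_list w Op = count_list w Cl" "w \<noteq> []"
  shows "height w (x + 1) = height w x + letter_val (letter_at w x)"
proof -
  define n where "n = length w"
  define i where "i = nat (x mod int n)"
  have n: "n > 0" using assms by (simp add: n_def)
  have i: "i < n" "x mod int n = int i" using n by (simp_all add: i_def nat_less_iff)
  have "height w x = sum_list (map letter_val (take i w))"
    by (simp add: height_def i_def n_def)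
  then have s: "height w x + letter_val (letter_at w x) = sum_list (map letter_val (take (Suc i) w))"
    using i by (simp add: take_Suc_conv_app_nth n_def letter_at_def i_def)
  have m: "(x + 1) mod int n = (if Suc i = n then 0 else int (Suc i))"
    using i mod_add_left_eq[of x "int n" 1] by (auto simp: add.commute)
  show ?thesis
  proof (cases "Suc i = n")
    case True
    then show ?thesis using s m assms by (simp add: height_def n_def sum_list_letter_val)
  next
    case False
    then show ?thesis using s m by (simp add: height_def n_def nat_add_distrib)
  qed
qed

lemma height_period: "height w (x + k * int (length w)) = height w x"
  by (simp add: height_def)

text \<open>An arc ends where the height first returns to its value at the left end.\<close>

definition word_arcs :: "letter list \<Rightarrow> (int \<times> int) set" where
  "word_arcs w = {(x, y). x < y \<and> height w (y + 1) = height w x \<and> (\<forall>z. x < z \<longrightarrow> z \<le> y \<longrightarrow> height w x < height w z)}"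

text \<open>Suppose \<open>x < x' \<le> y \<le> y'\<close>. The path is higher at \<open>x'\<close>
  than at \<open>x\<close>, and at \<open>y + 1\<close> it is back at the height of
  \<open>x\<close>. For \<open>y < y'\<close> it would still have to exceed the height of
  \<open>x'\<close> there; for \<open>y = y'\<close> the two heights would be equal.\<close>

lemma word_arcs_system: "word_arcs w \<in> arc_systems (int (length w))"
  unfolding arc_systems_def
proof (intro CollectI conjI allI impI)
  show "\<forall>(x, y)\<in>word_arcs w. x < y" by (auto simp: word_arcs_def)
next
  fix x y
  let ?n = "int (length w)"
  have per: "height w (z + ?n) = height w z" for z using height_period[of w z 1] by simp
  have per': "height w (y + ?n + 1) = height w (y + 1)" using per[of "y + 1"] by (simp add: algebra_simps)
  have "(\<forall>z. x + ?n < z \<longrightarrow> z \<le> y + ?n \<longrightarrow> height w x < height w z) \<longleftrightarrow>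
        (\<forall>z. x < z \<longrightarrow> z \<le> y \<longrightarrow> height w x < height w z)" (is "?L \<longleftrightarrow> ?R")
  proof
    assume ?L
    then show ?R using per by (metis add_less_cancel_right add_le_cancel_right)
  next
    assume R: ?R
    show ?L
    proof (intro allI impI)
      fix z assume "x + ?n < z" "z \<le> y + ?n"
      then show "height w x < height w z" using R[rule_format, of "z - ?n"] per[of "z - ?n"] by simp
    qed
  qed
  then show "(x + ?n, y + ?n) \<in> word_arcs w \<longleftrightarrow> (x, y) \<in> word_arcs w"
    by (simp add: word_arcs_def per per')
next
  fix x y x' y'
  assume a: "(x, y) \<in> word_arcs w" "(x', y') \<in> word_arcs w" "x \<le> x'" "x' \<le> y" "y \<le> y'"
  then have h: "height w (y + 1) = height w x" "height w (y' + 1) = height w x'"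
    and z: "\<And>z. x < z \<Longrightarrow> z \<le> y \<Longrightarrow> height w x < height w z"
    and z': "\<And>z. x' < z \<Longrightarrow> z \<le> y' \<Longrightarrow> height w x' < height w z"
    by (auto simp: word_arcs_def)
  have "\<not> x < x'"
  proof
    assume "x < x'"
    then show False using z[of x'] z'[of "y + 1"] h a by (cases "y = y'") auto
  qed
  moreover have "\<not> y < y'" if "x = x'"
  proof
    assume "y < y'"
    then show False using z'[of "y + 1"] h a that by auto
  qed
  ultimately show "x = x'" "y = y'" using a(3,5) by linarith+
qed

lemma word_arcs_Op:
  assumes "count_list w Op = count_list w Cl" "w \<noteq> []"
  shows "(\<exists>y. (x, y) \<in> word_arcs w) \<longleftrightarrow> letter_at w x = Op"
proof
  assume "\<exists>y. (x, y) \<in> word_arcs w"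
  then have "height w x < height w (x + 1)" by (auto simp: word_arcs_def)
  then show "letter_at w x = Op"
    using height_step[OF assms, of x] by (auto simp: letter_val_def split: letter.splits)
next
  assume "letter_at w x = Op"
  then have up: "height w (x + 1) = height w x + 1"
    using height_step[OF assms, of x] by (simp add: letter_val_def)
  \<comment> \<open>The first return to the old level is at \<open>x + 2 + d\<close>; the letter
    that causes it is one position earlier, at \<open>x + 1 + d\<close>, which is the right
    end.\<close>
  define d where "d = (LEAST d::nat. height w (x + 1 + int (Suc d)) = height w x)"
  \<comment> \<open>A return exists because the height recurs after one full period. Length 1 must
    be excluded, since the height would then be constant.\<close>
  have "length w \<noteq> 1" using up height_period[of w x 1] by auto
  then obtain m where m: "length w = Suc (Suc m)"
    using assms(2) by (cases w; cases "tl w") auto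
  have "height w (x + 1 + int (Suc m)) = height w x"
    using height_period[of w x 1] m by (simp add: algebra_simps)
  then have d: "height w (x + 1 + int (Suc d)) = height w x"
    unfolding d_def by (rule LeastI)
  have above: "height w x < height w (x + 1 + int k)" if "k \<le> d" for k
    using that
  proof (induction k)
    case 0
    then show ?case using up by simp
  next
    case (Suc k)
    have "height w (x + 1 + int (Suc k)) \<noteq> height w x"
      using not_less_Least[of k "\<lambda>d. height w (x + 1 + int (Suc d)) = height w x"] Suc.prems
      by (auto simp: d_def)
    \<comment> \<open>The path descends by at most 1 per step, so it cannot get below the old level
      without first hitting it.\<close>
    moreover have "height w (x + 1 + int (Suc k)) \<ge> height w (x + 1 + int k) - 1"
      using height_step[OF assms, of "x + 1 + int k"]
      by (auto simp: letter_val_def algebra_simps split: letter.splits)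
    ultimately show ?case using Suc by simp
  qed
  have "(x, x + 1 + int d) \<in> word_arcs w"
    unfolding word_arcs_def
  proof (intro CollectI case_prodI conjI allI impI)
    show "x < x + 1 + int d" by simp
    show "height w (x + 1 + int d + 1) = height w x" using d by (simp add: algebra_simps)
    fix z assume "x < z" "z \<le> x + 1 + int d"
    then show "height w x < height w z" using above[of "nat (z - x - 1)"] by (simp add: nat_le_iff)
  qed
  then show "\<exists>y. (x, y) \<in> word_arcs w" by blast
qed

text \<open>The mirror image of \<open>word_arcs_Op\<close>: the left end is found by walking left
  from \<open>y\<close> to the nearest position whose height is the one reached after
  \<open>y\<close>.\<close>

lemma word_arcs_Cl:
  assumes "count_list w Op = count_list w Cl" "w \<noteq> []"
  shows "(\<exists>x. (x, y) \<in> word_arcs w) \<longleftrightarrow> letter_at w y = Cl"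
proof
  assume "\<exists>x. (x, y) \<in> word_arcs w"
  then have "height w (y + 1) < height w y" by (auto simp: word_arcs_def)
  then show "letter_at w y = Cl"
    using height_step[OF assms, of y] by (auto simp: letter_val_def split: letter.splits)
next
  assume "letter_at w y = Cl"
  then have down: "height w (y + 1) = height w y - 1"
    using height_step[OF assms, of y] by (simp add: letter_val_def)
  define d where "d = (LEAST d::nat. height w (y - int (Suc d)) = height w (y + 1))"
  have "length w \<noteq> 1" using down height_period[of w y 1] by auto
  then obtain m where m: "length w = Suc (Suc m)"
    using assms(2) by (cases w; cases "tl w") auto
  have "height w (y - int (Suc m)) = height w (y + 1)"
    using height_period[of w "y - int (Suc m)" 1] m by (simp add: algebra_simps)
  then have d: "height w (y - int (Suc d)) = height w (y + 1)"
    unfolding d_def by (rule LeastI)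
  have above: "height w (y + 1) < height w (y - int k)" if "k \<le> d" for k
    using that
  proof (induction k)
    case 0
    then show ?case using down by simp
  next
    case (Suc k)
    have "height w (y - int (Suc k)) \<noteq> height w (y + 1)"
      using not_less_Least[of k "\<lambda>d. height w (y - int (Suc d)) = height w (y + 1)"] Suc.prems
      by (auto simp: d_def)
    moreover have "height w (y - int (Suc k)) \<ge> height w (y - int k) - 1"
      using height_step[OF assms, of "y - int (Suc k)"]
      by (auto simp: letter_val_def algebra_simps split: letter.splits)
    ultimately show ?case using Suc by simp
  qed
  have "(y - int (Suc d), y) \<in> word_arcs w"
    unfolding word_arcs_def
  proof (intro CollectI case_prodI conjI allI impI)
    show "y - int (Suc d) < y" by simp
    show "height w (y + 1) = height w (y - int (Suc d))" using d by simp
    fix z assume "y - int (Suc d) < z" "z \<le> y"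
    then show "height w (y - int (Suc d)) < height w z"
      using above[of "nat (y - z)"] d by (simp add: nat_le_iff)
  qed
  then show "\<exists>x. (x, y) \<in> word_arcs w" by blast
qed

lemma arc_word_word_arcs:
  assumes "w \<in> words n" "n > 0"
  shows "arc_word n (word_arcs w) = w"
proof (rule nth_equalityI)
  have len: "length w = n" "w \<noteq> []" and bal: "count_list w Op = count_list w Cl"
    using assms by (auto simp: words_def)
  show "length (arc_word n (word_arcs w)) = length w" using len by (simp add: arc_word_def)
  fix i assume "i < length (arc_word n (word_arcs w))"
  then have i: "i < n" by (simp add: arc_word_def)
  have A: "word_arcs w \<in> arc_systems (int n)" using word_arcs_system[of w] len by simp
  have "arc_word n (word_arcs w) ! i = Op \<longleftrightarrow> w ! i = Op"
    using arc_word_Op[OF A assms(2), of "int i"] word_arcs_Op[OF bal len(2), of "int i"] i len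
    by (simp add: letter_at_def)
  moreover have "arc_word n (word_arcs w) ! i = Cl \<longleftrightarrow> w ! i = Cl"
    using arc_word_Cl[OF A assms(2), of "int i"] word_arcs_Cl[OF bal len(2), of "int i"] i len
    by (simp add: letter_at_def)
  ultimately show "arc_word n (word_arcs w) ! i = w ! i"
    by (metis letter.exhaust)
qed

lemma word_arcs_split:
  assumes "w \<in> words n" "n > 0"
  shows "word_arcs w \<in> split_arcs (int n)"
proof -
  have len: "length w = n" "w \<noteq> []" and bal: "count_list w Op = count_list w Cl"
    and noc: "no_op_cl w"
    using assms by (auto simp: words_def)
  have "x mod int n = int n - 1" if x: "(x, x + 1) \<in> word_arcs w" for x
  proof (rule ccontr)
    define i where "i = nat (x mod int n)"
    assume "x mod int n \<noteq> int n - 1"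
    moreover have xi: "x mod int n = int i" "i < n" using assms(2) by (simp_all add: i_def nat_less_iff)
    ultimately have i: "Suc i < n" by linarith
    have "(x + 1) mod int n = int (Suc i)"
      using i xi mod_add_left_eq[of x "int n" 1] by (auto simp: add.commute)
    then have "letter_at w (x + 1) = w ! Suc i" "letter_at w x = w ! i"
      using xi len by (auto simp: letter_at_def simp del: of_nat_Suc)
    then have "w ! i = Op" "w ! Suc i = Cl"
      using x word_arcs_Op[OF bal len(2), of x] word_arcs_Cl[OF bal len(2), of "x + 1"] by auto
    then show False using noc i len by (auto simp: successively_conv_nth)
  qed
  then show ?thesis using word_arcs_system[of w] len by (simp add: split_arcs_def)
qed

lemma card_split_arcs:
  assumes "n > 0"
  shows "card (split_arcs (int n)) = card (words n)"
proof (rule bij_betw_same_card[of "arc_word n"])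
  have "split_arcs (int n) \<subseteq> arc_systems (int n)" by (auto simp: split_arcs_def)
  then have "inj_on (arc_word n) (split_arcs (int n))"
    using inj_on_arc_word[OF assms] inj_on_subset by blast
  moreover have "arc_word n ` split_arcs (int n) = words n"
    using arc_word_in_words[OF _ assms] arc_word_word_arcs[OF _ assms] word_arcs_split[OF _ assms]
    by (force simp: image_iff)
  ultimately show "bij_betw (arc_word n) (split_arcs (int n)) (words n)"
    by (simp add: bij_betw_def)
qed

subsection \<open>Pairings and dominoes\<close>

definition row_point :: "real \<Rightarrow> nat \<Rightarrow> complex" where
  "row_point s i = Complex (real i) s"

lemma row_point_eq_iff [simp]: "row_point s i = row_point t j \<longleftrightarrow> s = t \<and> i = j"
  by (auto simp: row_point_def)

lemma marked_points_row: "marked_points p q = row_point 0 ` {..<p} \<union> row_point 1 ` {..<q}"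
  by (simp add: marked_points_def row_point_def)

lemma in_row_hull:
  assumes "z \<in> convex hull {row_point s i, row_point s j}" "i \<le> j"
  shows "Im z = s \<and> real i \<le> Re z \<and> Re z \<le> real j"
proof -
  obtain u where u: "0 \<le> u" "u \<le> 1" "z = (1 - u) *\<^sub>R row_point s i + u *\<^sub>R row_point s j"
    using assms(1) by (auto simp: segment_convex_hull[symmetric] in_segment)
  have "Re z = real i + u * (real j - real i)" "Im z = s"
    by (simp_all add: u(3) row_point_def algebra_simps)
  moreover have "0 \<le> u * (real j - real i)" "u * (real j - real i) \<le> real j - real i"
    using u(1,2) assms(2) by (auto intro: mult_left_le_one_le)
  ultimately show ?thesis by auto
qed

lemma row_in_row_hull:
  assumes "i \<le> k" "k \<le> j"
  shows "row_point s k \<in> convex hull {row_point s i, row_point s j}"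
proof (cases "i = j")
  case True
  then show ?thesis using assms by simp
next
  case False
  define u where "u = (real k - real i) / (real j - real i)"
  have "u * (real j - real i) = real k - real i" using False by (simp add: u_def)
  then have "row_point s k = (1 - u) *\<^sub>R row_point s i + u *\<^sub>R row_point s j"
    by (simp add: row_point_def complex_eq_iff algebra_simps)
  moreover have "0 \<le> u" "u \<le> 1" using assms False by (auto simp: u_def divide_simps)
  ultimately show ?thesis by (auto simp: segment_convex_hull[symmetric] in_segment)
qed

text \<open>Since the rows have imaginary parts 0 and 1, the imaginary part of a point is itself the
  parameter along the segment.\<close>

lemma in_cross_hull:
  "z \<in> convex hull {row_point 0 i, row_point 1 j} \<longleftrightarrow>
   0 \<le> Im z \<and> Im z \<le> 1 \<and> Re z = (1 - Im z) * real i + Im z * real j"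
proof
  assume "z \<in> convex hull {row_point 0 i, row_point 1 j}"
  then obtain u where u: "0 \<le> u" "u \<le> 1" "z = (1 - u) *\<^sub>R row_point 0 i + u *\<^sub>R row_point 1 j"
    by (auto simp: segment_convex_hull[symmetric] in_segment)
  then show "0 \<le> Im z \<and> Im z \<le> 1 \<and> Re z = (1 - Im z) * real i + Im z * real j"
    by (simp add: row_point_def)
next
  assume z: "0 \<le> Im z \<and> Im z \<le> 1 \<and> Re z = (1 - Im z) * real i + Im z * real j"
  then have "z = (1 - Im z) *\<^sub>R row_point 0 i + Im z *\<^sub>R row_point 1 j"
    by (simp add: row_point_def complex_eq_iff)
  then show "z \<in> convex hull {row_point 0 i, row_point 1 j}"
    using z by (auto simp: segment_convex_hull[symmetric] in_segment)
qed

lemma cross_hulls_meet: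
  assumes "i < i'" "j' \<le> j"
  shows "convex hull {row_point 0 i, row_point 1 j} \<inter> convex hull {row_point 0 i', row_point 1 j'} \<noteq> {}"
proof -
  define d where "d = (real i' - real i) + (real j - real j')"
  \<comment> \<open>The height at which the two segments have equal real part. Their horizontal
    distance is \<open>i' - i\<close> at the bottom and \<open>j' - j\<close> at the top, and it
    vanishes at this ratio.\<close>
  define y where "y = (real i' - real i) / d"
  have d: "d > 0" using assms by (simp add: d_def)
  have y: "0 \<le> y" "y \<le> 1" using assms d by (auto simp: y_def d_def divide_simps)
  have "y * d = real i' - real i" using d by (simp add: y_def)
  then have "(1 - y) * real i + y * real j = (1 - y) * real i' + y * real j'"
    by (simp add: d_def algebra_simps)
  then have "Complex ((1 - y) * real i + y * real j) y \<in>
      convex hull {row_point 0 i, row_point 1 j} \<inter> convex hull {row_point 0 i', row_point 1 j'}"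
    using y by (simp add: in_cross_hull)
  then show ?thesis by blast
qed

text \<open>If both ends were ordered alike, the horizontal distance would be a convex combination
  of two positive numbers at every height.\<close>

lemma cross_hulls_order:
  assumes "z \<in> convex hull {row_point 0 i, row_point 1 j}" "z \<in> convex hull {row_point 0 i', row_point 1 j'}" "i < i'"
  shows "\<not> j < j'"
proof
  assume "j < j'"
  define y where "y = Im z"
  have "0 \<le> y" "y \<le> 1" "(1 - y) * real i + y * real j = (1 - y) * real i' + y * real j'"
    using assms by (auto simp: in_cross_hull y_def)
  then have e: "(1 - y) * (real i' - real i) + y * (real j' - real j) = 0" and y: "0 \<le> y" "y \<le> 1"
    by (auto simp: algebra_simps)
  have "(1 - y) * (real i' - real i) \<ge> 0" "y * (real j' - real j) \<ge> 0"
    using y assms \<open>j < j'\<close> by auto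
  then have "(1 - y) * (real i' - real i) = 0" "y * (real j' - real j) = 0" using e by linarith+
  then show False using assms \<open>j < j'\<close> by simp
qed

section \<open>The pairing built from two sets of dominoes\<close>

definition rank_in :: "nat set \<Rightarrow> nat \<Rightarrow> nat" where
  "rank_in V j = card (V \<inter> {..<j})"

lemma rank_less: "i \<in> V \<Longrightarrow> i < j \<Longrightarrow> rank_in V i < rank_in V j"
  unfolding rank_in_def by (rule psubset_card_mono) auto

lemma rank_inj: "i \<in> V \<Longrightarrow> j \<in> V \<Longrightarrow> rank_in V i = rank_in V j \<Longrightarrow> i = j"
  using rank_less by (metis less_irrefl linorder_neqE_nat)

lemma rank_image:
  assumes "finite V"
  shows "rank_in V ` V = {..<card V}"
proof (rule card_subset_eq)
  show "rank_in V ` V \<subseteq> {..<card V}"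
  proof clarsimp
    fix j assume "j \<in> V"
    then show "rank_in V j < card V"
      unfolding rank_in_def using assms by (intro psubset_card_mono) auto
  qed
  have "inj_on (rank_in V) V" using rank_inj by (auto intro: inj_onI)
  then show "card (rank_in V ` V) = card {..<card V}" by (simp add: card_image)
qed simp

definition rest :: "nat \<Rightarrow> nat set \<Rightarrow> nat set" where
  "rest n B = {..<n} - B - Suc ` B"

lemma finite_rest [simp]: "finite (rest n B)"
  by (simp add: rest_def)

lemma card_rest:
  assumes "spaced n B"
  shows "card (rest n B) + 2 * card B = n"
proof -
  have sub: "B \<subseteq> {..<n}" "Suc ` B \<subseteq> {..<n}" and dis: "B \<inter> Suc ` B = {}"
    using assms by (auto simp: spaced_def dest: Suc_lessD)
  then have fin: "finite B" using finite_subset by blast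
  have "card (B \<union> Suc ` B) = 2 * card B"
    using fin dis by (simp add: card_Un_disjoint card_image)
  moreover have "card (rest n B) = card ({..<n} - (B \<union> Suc ` B))"
    by (simp add: rest_def Diff_eq Int_assoc)
  moreover have "\<dots> = n - card (B \<union> Suc ` B)"
    using fin sub by (subst card_Diff_subset) auto
  moreover have "card (B \<union> Suc ` B) \<le> n"
    using card_mono[of "{..<n}" "B \<union> Suc ` B"] sub by simp
  ultimately show ?thesis by simp
qed

definition horizontals :: "real \<Rightarrow> nat set \<Rightarrow> complex set set" where
  "horizontals s B = (\<lambda>i. {row_point s i, row_point s (Suc i)}) ` B"

text \<open>Equal ranks express that the remaining points of both rows are joined in order, which is
  the only way to join them without intersections.\<close>

definition crossings :: "nat set \<Rightarrow> nat set \<Rightarrow> complex set set" where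
  "crossings U V = {{row_point 0 i, row_point 1 j} | i j. i \<in> U \<and> j \<in> V \<and> rank_in U i = rank_in V j}"

definition domino_pairing :: "nat \<Rightarrow> nat set \<Rightarrow> nat set \<Rightarrow> complex set set" where
  "domino_pairing n B T = horizontals 0 B \<union> horizontals 1 T \<union> crossings (rest n B) (rest n T)"

definition pairings :: "nat \<Rightarrow> complex set set set" where
  "pairings n = {M. partition_on (marked_points n n) M \<and> (\<forall>e\<in>M. card e = 2) \<and> disjoint_segments M}"

text \<open>Unit intervals that meet start at equal or consecutive integers, and
  \<open>spaced\<close> forbids consecutive starts.\<close>

lemma hulls_meet_horizontals:
  assumes "spaced n B" "e \<in> horizontals s B" "f \<in> horizontals s B"
    "z \<in> convex hull e" "z \<in> convex hull f"
  shows "e = f"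
proof -
  obtain i j where ij: "i \<in> B" "j \<in> B" "e = {row_point s i, row_point s (Suc i)}" "f = {row_point s j, row_point s (Suc j)}"
    using assms by (auto simp: horizontals_def)
  have "real i \<le> Re z" "Re z \<le> real (Suc i)" "real j \<le> Re z" "Re z \<le> real (Suc j)"
    using in_row_hull[of z s i "Suc i"] in_row_hull[of z s j "Suc j"] ij assms by auto
  then have "real i \<le> real (Suc j)" "real j \<le> real (Suc i)" by linarith+
  then have "i = j \<or> i = Suc j \<or> j = Suc i" by linarith
  then show ?thesis using ij assms(1) by (auto simp: spaced_def)
qed

lemma hulls_disjoint_horizontals:
  assumes "e \<in> horizontals s B" "f \<in> horizontals t T" "s \<noteq> t"
  shows "convex hull e \<inter> convex hull f = {}"
proof -
  have "Im z = s" if "z \<in> convex hull e" for z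
    using that assms(1) in_row_hull[of z s] by (auto simp: horizontals_def)
  moreover have "Im z = t" if "z \<in> convex hull f" for z
    using that assms(2) in_row_hull[of z t] by (auto simp: horizontals_def)
  ultimately show ?thesis using assms(3) by blast
qed

text \<open>A segment between the rows meets each row only in its own endpoint. That endpoint would
  be one of the two cells of a domino, which \<open>rest\<close> has removed.\<close>

lemma hulls_disjoint_horizontal_crossing:
  assumes "e \<in> horizontals s B" "f \<in> crossings (rest n B0) (rest n B1)"
    "s = 0 \<and> B = B0 \<or> s = 1 \<and> B = B1"
  shows "convex hull e \<inter> convex hull f = {}"
proof (rule ccontr)
  assume "convex hull e \<inter> convex hull f \<noteq> {}"
  then obtain z where z: "z \<in> convex hull e" "z \<in> convex hull f" by blast
  obtain k where k: "k \<in> B" "e = {row_point s k, row_point s (Suc k)}" using assms by (auto simp: horizontals_def)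
  obtain i j where ij: "i \<in> rest n B0" "j \<in> rest n B1" "f = {row_point 0 i, row_point 1 j}"
    using assms by (auto simp: crossings_def)
  have e: "Im z = s" "real k \<le> Re z" "Re z \<le> real (Suc k)"
    using in_row_hull[of z s k "Suc k"] z k by auto
  have f: "Re z = (1 - Im z) * real i + Im z * real j"
    using z ij in_cross_hull by blast
  from assms(3) show False
  proof
    assume s: "s = 0 \<and> B = B0"
    then have "real k \<le> real i" "real i \<le> real (Suc k)" using e f by auto
    then have "i = k \<or> i = Suc k" by linarith
    then show False using ij k s by (auto simp: rest_def)
  next
    assume s: "s = 1 \<and> B = B1"
    then have "real k \<le> real j" "real j \<le> real (Suc k)" using e f by auto
    then have "j = k \<or> j = Suc k" by linarith
    then show False using ij k s by (auto simp: rest_def)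
  qed
qed

lemma hulls_meet_crossings:
  assumes "e \<in> crossings U V" "f \<in> crossings U V" "z \<in> convex hull e" "z \<in> convex hull f"
  shows "e = f"
proof -
  obtain i j where e: "i \<in> U" "j \<in> V" "rank_in U i = rank_in V j" "e = {row_point 0 i, row_point 1 j}"
    using assms by (auto simp: crossings_def)
  obtain i' j' where f: "i' \<in> U" "j' \<in> V" "rank_in U i' = rank_in V j'" "f = {row_point 0 i', row_point 1 j'}"
    using assms by (auto simp: crossings_def)
  have "\<not> i < i'"
  proof
    assume "i < i'"
    then have "rank_in V j < rank_in V j'" using rank_less e f by metis
    then have "j < j'" using rank_less[of j' V j] f by (cases j j' rule: linorder_cases) auto
    then show False using cross_hulls_order[of z i j i' j'] assms e f \<open>i < i'\<close> by simp
  qed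
  moreover have "\<not> i' < i"
  proof
    assume "i' < i"
    then have "rank_in V j' < rank_in V j" using rank_less e f by metis
    then have "j' < j" using rank_less[of j V j'] e by (cases j j' rule: linorder_cases) auto
    then show False using cross_hulls_order[of z i' j' i j] assms e f \<open>i' < i\<close> by simp
  qed
  ultimately have "i = i'" by simp
  then show ?thesis using e f rank_inj[of j V j'] by auto
qed

lemma disjoint_segments_domino_pairing:
  assumes "spaced n B" "spaced n T"
  shows "disjoint_segments (domino_pairing n B T)"
  unfolding disjoint_segments_def
proof (rule pairwiseI)
  fix e f assume ef: "e \<in> domino_pairing n B T" "f \<in> domino_pairing n B T" "e \<noteq> f"
  note hX = hulls_disjoint_horizontal_crossing[where n = n and ?B0.0 = B and ?B1.0 = T]
  have cases: "e \<in> horizontals 0 B \<or> e \<in> horizontals 1 T \<or> e \<in> crossings (rest n B) (rest n T)"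
    "f \<in> horizontals 0 B \<or> f \<in> horizontals 1 T \<or> f \<in> crossings (rest n B) (rest n T)"
    using ef by (auto simp: domino_pairing_def)
  have same: "convex hull e \<inter> convex hull f = {}"
    if "\<And>z. z \<in> convex hull e \<Longrightarrow> z \<in> convex hull f \<Longrightarrow> e = f"
    using that ef(3) by auto
  have hor: "convex hull a \<inter> convex hull b = {} \<and> convex hull b \<inter> convex hull a = {}"
    if "a \<in> horizontals 0 B" "b \<in> horizontals 1 T" for a b
    using that hulls_disjoint_horizontals[of a 0 B b 1 T] by (simp add: Int_commute)
  have cross: "convex hull a \<inter> convex hull b = {} \<and> convex hull b \<inter> convex hull a = {}"
    if "a \<in> horizontals 0 B \<or> a \<in> horizontals 1 T" "b \<in> crossings (rest n B) (rest n T)" for a b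
    using that hX[of a 0 B b] hX[of a 1 T b] by (auto simp: Int_commute)
  show "convex hull e \<inter> convex hull f = {}"
    using cases
  proof (elim disjE)
    assume "e \<in> horizontals 0 B" "f \<in> horizontals 0 B"
    then show ?thesis by (intro same hulls_meet_horizontals[OF assms(1)])
  next
    assume "e \<in> horizontals 1 T" "f \<in> horizontals 1 T"
    then show ?thesis by (intro same hulls_meet_horizontals[OF assms(2)])
  next
    assume "e \<in> crossings (rest n B) (rest n T)" "f \<in> crossings (rest n B) (rest n T)"
    then show ?thesis by (intro same hulls_meet_crossings)
  qed (use hor[of e f] hor[of f e] cross[of e f] cross[of f e] in simp_all)
qed

text \<open>Equally many dominoes leave equally many free points, so the same ranks occur in both
  rows and each free point finds a partner.\<close>

lemma Union_domino_pairing: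
  assumes "spaced n B" "spaced n T" "card B = card T"
  shows "\<Union>(domino_pairing n B T) = marked_points n n"
proof
  show "\<Union>(domino_pairing n B T) \<subseteq> marked_points n n"
  proof -
    have "i < n" if "Suc i < n" for i using that by simp
    then show ?thesis
      using assms(1,2) by (auto simp: domino_pairing_def horizontals_def crossings_def
          marked_points_row rest_def spaced_def)
  qed
  have "card (rest n B) = card (rest n T)"
    using card_rest[OF assms(1)] card_rest[OF assms(2)] assms(3) by simp
  then have ranks: "rank_in (rest n B) ` rest n B = rank_in (rest n T) ` rest n T"
    by (simp add: rank_image)
  have "row_point 0 i \<in> \<Union>(domino_pairing n B T)" if "i < n" for i
  proof -
    have "i \<in> B \<or> (\<exists>k\<in>B. i = Suc k) \<or> i \<in> rest n B"
      using that by (auto simp: rest_def)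
    then show ?thesis
    proof (elim disjE)
      assume r: "i \<in> rest n B"
      then obtain j where "j \<in> rest n T" "rank_in (rest n B) i = rank_in (rest n T) j"
        using ranks by (metis imageE imageI)
      then have "{row_point 0 i, row_point 1 j} \<in> domino_pairing n B T"
        using r by (auto simp: domino_pairing_def crossings_def)
      then show ?thesis by blast
    qed (auto simp: domino_pairing_def horizontals_def)
  qed
  moreover have "row_point 1 j \<in> \<Union>(domino_pairing n B T)" if "j < n" for j
  proof -
    have "j \<in> T \<or> (\<exists>k\<in>T. j = Suc k) \<or> j \<in> rest n T"
      using that by (auto simp: rest_def)
    then show ?thesis
    proof (elim disjE)
      assume r: "j \<in> rest n T"
      then obtain i where "i \<in> rest n B" "rank_in (rest n B) i = rank_in (rest n T) j"
        using ranks by (metis imageE imageI)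
      then have "{row_point 0 i, row_point 1 j} \<in> domino_pairing n B T"
        using r by (auto simp: domino_pairing_def crossings_def)
      then show ?thesis by blast
    qed (auto simp: domino_pairing_def horizontals_def)
  qed
  ultimately show "marked_points n n \<subseteq> \<Union>(domino_pairing n B T)"
    by (auto simp: marked_points_row)
qed

lemma domino_pairing_in_pairings:
  assumes "(B, T) \<in> domino_pairs n"
  shows "domino_pairing n B T \<in> pairings n"
proof -
  have BT: "spaced n B" "spaced n T" "card B = card T" using assms by (auto simp: domino_pairs_def)
  have seg: "disjoint_segments (domino_pairing n B T)"
    using disjoint_segments_domino_pairing BT by blast
  have two: "card e = 2" if "e \<in> domino_pairing n B T" for e
    using that by (auto simp: domino_pairing_def horizontals_def crossings_def)
  have "disjoint (domino_pairing n B T)"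
  proof (rule disjointI)
    fix e f assume "e \<in> domino_pairing n B T" "f \<in> domino_pairing n B T" "e \<noteq> f"
    then have "convex hull e \<inter> convex hull f = {}"
      using seg by (auto simp: disjoint_segments_def pairwise_def)
    then show "e \<inter> f = {}" using hull_subset[of e convex] hull_subset[of f convex] by blast
  qed
  moreover have "{} \<notin> domino_pairing n B T" using two by fastforce
  ultimately have "partition_on (marked_points n n) (domino_pairing n B T)"
    using Union_domino_pairing[OF BT] by (auto simp: partition_on_def)
  then show ?thesis using seg two by (simp add: pairings_def)
qed

section \<open>Recovering the dominoes from a pairing\<close>

definition left_ends :: "real \<Rightarrow> complex set set \<Rightarrow> nat set" where
  "left_ends s M = {i. {row_point s i, row_point s (Suc i)} \<in> M}"

lemma left_ends_domino_pairing:
  "left_ends 0 (domino_pairing n B T) = B" "left_ends 1 (domino_pairing n B T) = T"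
  by (auto simp: left_ends_def domino_pairing_def horizontals_def crossings_def doubleton_eq_iff)

context
  fixes n :: nat and M
  assumes M: "M \<in> pairings n"
begin

lemma pairing_eq_if_meet:
  assumes "e \<in> M" "f \<in> M" "z \<in> convex hull e" "z \<in> convex hull f"
  shows "e = f"
  using assms M by (auto simp: pairings_def disjoint_segments_def pairwise_def)

lemma pairing_eq_if_common:
  assumes "e \<in> M" "f \<in> M" "z \<in> e" "z \<in> f"
  shows "e = f"
  using pairing_eq_if_meet assms by (meson hull_inc)

lemma pairing_points:
  assumes "{row_point s i, row_point t j} \<in> M"
  shows "i < n \<and> j < n"
proof -
  have "{row_point s i, row_point t j} \<subseteq> marked_points n n"
    using M assms by (auto simp: pairings_def partition_on_def)
  then show ?thesis by (auto simp: marked_points_row)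
qed

lemma pairing_covers:
  assumes "i < n" "s = 0 \<or> s = 1"
  obtains t j where "{row_point s i, row_point t j} \<in> M" "t = 0 \<or> t = 1" "(t, j) \<noteq> (s, i)"
proof -
  have "row_point s i \<in> marked_points n n" using assms by (auto simp: marked_points_row)
  then obtain e where e: "e \<in> M" "row_point s i \<in> e"
    using M by (auto simp: pairings_def partition_on_def)
  then have "card e = 2" using M by (auto simp: pairings_def)
  then obtain q where q: "e = {row_point s i, q}" "q \<noteq> row_point s i"
    using e by (metis card_2_iff doubleton_eq_iff insertE singletonD)
  have "q \<in> marked_points n n" using M e q by (auto simp: pairings_def partition_on_def)
  then obtain t j where "q = row_point t j" "t = 0 \<or> t = 1" by (auto simp: marked_points_row)
  then show ?thesis using that[of t j] e q by auto
qed

text \<open>A marked point between the two ends would lie on the segment while being an endpoint of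
  a segment of its own, as every marked point is paired.\<close>

lemma pairing_adjacent:
  assumes "{row_point s i, row_point s j} \<in> M" "i < j" "s = 0 \<or> s = 1"
  shows "j = Suc i"
proof (rule ccontr)
  assume "j \<noteq> Suc i"
  then have j: "Suc i < j" using assms by simp
  then have "Suc i < n" using pairing_points[OF assms(1)] by simp
  then obtain t k where tk: "{row_point s (Suc i), row_point t k} \<in> M"
    using pairing_covers assms(3) by metis
  have "row_point s (Suc i) \<in> convex hull {row_point s i, row_point s j}"
    using row_in_row_hull j by simp
  then have "{row_point s (Suc i), row_point t k} = {row_point s i, row_point s j}"
    using pairing_eq_if_meet[OF tk assms(1)] hull_inc[of "row_point s (Suc i)"] by blast
  then show False using j by (auto simp: doubleton_eq_iff)
qed

lemma spaced_left_ends: "spaced n (left_ends s M)"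
  unfolding spaced_def
proof
  fix i assume "i \<in> left_ends s M"
  then have i: "{row_point s i, row_point s (Suc i)} \<in> M" by (simp add: left_ends_def)
  have "{row_point s (Suc i), row_point s (Suc (Suc i))} \<notin> M"
  proof
    assume "{row_point s (Suc i), row_point s (Suc (Suc i))} \<in> M"
    from pairing_eq_if_common[OF i this, of "row_point s (Suc i)"] show False
      by (auto simp: doubleton_eq_iff)
  qed
  then show "Suc i < n \<and> Suc i \<notin> left_ends s M"
    using pairing_points[OF i] by (simp add: left_ends_def)
qed

lemma pairing_rest:
  assumes "i \<in> rest n (left_ends s M)" "s = 0 \<or> s = 1"
  shows "\<exists>j. {row_point s i, row_point (1 - s) j} \<in> M"
proof -
  have i: "i < n" "i \<notin> left_ends s M" "i \<notin> Suc ` left_ends s M" using assms by (auto simp: rest_def)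
  obtain t j where tj: "{row_point s i, row_point t j} \<in> M" "t = 0 \<or> t = 1" "(t, j) \<noteq> (s, i)"
    using pairing_covers[OF i(1) assms(2)] by metis
  have "t \<noteq> s"
  proof
    assume t: "t = s"
    then consider "i < j" | "j < i" using tj by force
    then show False
    proof cases
      case 1
      then show False using pairing_adjacent[of s i j] tj t i assms by (auto simp: left_ends_def)
    next
      case 2
      moreover have "{row_point s j, row_point s i} \<in> M" using tj t by (simp add: insert_commute)
      ultimately have "i = Suc j" "j \<in> left_ends s M"
        using pairing_adjacent[of s j i] assms by (auto simp: left_ends_def)
      then show False using i by blast
    qed
  qed
  then have "t = 1 - s" using tj assms by auto
  then show ?thesis using tj by auto
qed

lemma pairing_cross_rest:
  assumes "{row_point s i, row_point t j} \<in> M" "s \<noteq> t"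
  shows "i \<in> rest n (left_ends s M)"
proof -
  have "i \<notin> left_ends s M"
  proof
    assume "i \<in> left_ends s M"
    then have i: "{row_point s i, row_point s (Suc i)} \<in> M" by (simp add: left_ends_def)
    show False using pairing_eq_if_common[OF assms(1) i, of "row_point s i"] assms(2)
      by (auto simp: doubleton_eq_iff)
  qed
  moreover have "i \<notin> Suc ` left_ends s M"
  proof
    assume "i \<in> Suc ` left_ends s M"
    then obtain k where k: "i = Suc k" "{row_point s k, row_point s (Suc k)} \<in> M" by (auto simp: left_ends_def)
    show False using pairing_eq_if_common[OF assms(1) k(2), of "row_point s i"] assms(2) k(1)
      by (auto simp: doubleton_eq_iff)
  qed
  ultimately show ?thesis using pairing_points[OF assms(1)] by (simp add: rest_def)
qed

lemma pairing_cross_mono: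
  assumes "{row_point 0 i, row_point 1 j} \<in> M" "{row_point 0 i', row_point 1 j'} \<in> M"
  shows "i < i' \<longleftrightarrow> j < j'"
proof -
  have *: "b < b'" if m: "{row_point 0 a, row_point 1 b} \<in> M" "{row_point 0 a', row_point 1 b'} \<in> M" and "a < a'" for a b a' b'
  proof (rule ccontr)
    assume "\<not> b < b'"
    then obtain z where "z \<in> convex hull {row_point 0 a, row_point 1 b}" "z \<in> convex hull {row_point 0 a', row_point 1 b'}"
      using cross_hulls_meet[of a a' b' b] \<open>a < a'\<close> by auto
    from pairing_eq_if_meet[OF m this] show False using \<open>a < a'\<close> by (auto simp: doubleton_eq_iff)
  qed
  have "j = j'" if "i = i'"
    using pairing_eq_if_common[OF assms, of "row_point 0 i"] that by (auto simp: doubleton_eq_iff)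
  then show ?thesis using *[OF assms] *[OF assms(2,1)] by (metis less_asym linorder_neqE_nat less_irrefl)
qed

lemma pairing_cross_unique:
  assumes "{row_point 0 i, row_point 1 j} \<in> M" "{row_point 0 i', row_point 1 j'} \<in> M"
  shows "i = i' \<longleftrightarrow> j = j'"
  using pairing_cross_mono[OF assms] pairing_cross_mono[OF assms(2,1)] by auto

text \<open>Left general in \<open>X\<close> and \<open>Y\<close> to serve twice: for the free
  points to the left of a given crossing, which yields equal ranks, and for all free points, which
  yields equally many dominoes.\<close>

lemma pairing_cross_card:
  assumes "X \<subseteq> rest n (left_ends 0 M)" "Y \<subseteq> rest n (left_ends 1 M)"
    and XY: "\<And>i j. {row_point 0 i, row_point 1 j} \<in> M \<Longrightarrow> i \<in> X \<longleftrightarrow> j \<in> Y"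
  shows "card X = card Y"
proof (rule card_eq_if_matching[where R = "\<lambda>i j. {row_point 0 i, row_point 1 j} \<in> M"])
  fix i assume "i \<in> X"
  then show "\<exists>j\<in>Y. {row_point 0 i, row_point 1 j} \<in> M" using pairing_rest[of i 0] XY assms(1) by force
next
  fix j assume "j \<in> Y"
  then have "\<exists>i. {row_point 1 j, row_point 0 i} \<in> M" using pairing_rest[of j 1] assms(2) by force
  then show "\<exists>i\<in>X. {row_point 0 i, row_point 1 j} \<in> M" using XY \<open>j \<in> Y\<close> by (metis insert_commute)
qed (use pairing_cross_unique in blast)+

lemma pairing_cross_rank:
  assumes "{row_point 0 i, row_point 1 j} \<in> M"
  shows "rank_in (rest n (left_ends 0 M)) i = rank_in (rest n (left_ends 1 M)) j"
  unfolding rank_in_def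
proof (rule pairing_cross_card)
  fix i' j' assume c: "{row_point 0 i', row_point 1 j'} \<in> M"
  then have "i' \<in> rest n (left_ends 0 M)" "j' \<in> rest n (left_ends 1 M)"
    using pairing_cross_rest[of 0 i' 1 j'] pairing_cross_rest[of 1 j' 0 i'] by (auto simp: insert_commute)
  then show "i' \<in> rest n (left_ends 0 M) \<inter> {..<i} \<longleftrightarrow> j' \<in> rest n (left_ends 1 M) \<inter> {..<j}"
    using pairing_cross_mono[OF c assms] by simp
qed auto

lemma left_ends_in_domino_pairs: "(left_ends 0 M, left_ends 1 M) \<in> domino_pairs n"
proof -
  have "card (rest n (left_ends 0 M)) = card (rest n (left_ends 1 M))"
  proof (rule pairing_cross_card)
    fix i j assume "{row_point 0 i, row_point 1 j} \<in> M"
    then show "i \<in> rest n (left_ends 0 M) \<longleftrightarrow> j \<in> rest n (left_ends 1 M)"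
      using pairing_cross_rest[of 0 i 1 j] pairing_cross_rest[of 1 j 0 i] by (auto simp: insert_commute)
  qed auto
  then show ?thesis
    using card_rest[OF spaced_left_ends[of 0]] card_rest[OF spaced_left_ends[of 1]] spaced_left_ends
    by (simp add: domino_pairs_def)
qed

lemma domino_pairing_left_ends: "domino_pairing n (left_ends 0 M) (left_ends 1 M) = M" (is "?P = M")
proof
  show sub: "?P \<subseteq> M"
  proof
    fix e assume "e \<in> ?P"
    then consider "e \<in> horizontals 0 (left_ends 0 M)" | "e \<in> horizontals 1 (left_ends 1 M)"
      | "e \<in> crossings (rest n (left_ends 0 M)) (rest n (left_ends 1 M))"
      by (auto simp: domino_pairing_def)
    then show "e \<in> M"
    proof cases
      case 3
      then obtain i j where ij: "i \<in> rest n (left_ends 0 M)" "j \<in> rest n (left_ends 1 M)"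
        "rank_in (rest n (left_ends 0 M)) i = rank_in (rest n (left_ends 1 M)) j" "e = {row_point 0 i, row_point 1 j}"
        by (auto simp: crossings_def)
      obtain j' where j': "{row_point 0 i, row_point 1 j'} \<in> M" using pairing_rest[of i 0] ij by auto
      moreover have "j' \<in> rest n (left_ends 1 M)"
        using pairing_cross_rest[of 1 j' 0 i] j' by (simp add: insert_commute)
      ultimately have "j' = j" using pairing_cross_rank ij rank_inj by metis
      then show ?thesis using j' ij by simp
    qed (auto simp: horizontals_def left_ends_def)
  qed
  \<comment> \<open>The segments of \<open>?P\<close> lie in \<open>M\<close> and already cover all
    marked points. So any \<open>e\<close> in \<open>M\<close> shares an endpoint with one of them
    and equals it.\<close>
  show "M \<subseteq> ?P"
  proof
    fix e assume e: "e \<in> M"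
    have cov: "row_point s i \<in> \<Union>(?P)"
      if "row_point s i \<in> marked_points n n" for s i
      using that left_ends_in_domino_pairs Union_domino_pairing by (auto simp: domino_pairs_def)
    have "card e = 2" "e \<subseteq> marked_points n n" using e M by (auto simp: pairings_def partition_on_def)
    then obtain s i where si: "row_point s i \<in> e" "row_point s i \<in> marked_points n n"
      by (fastforce simp: card_2_iff marked_points_row)
    then obtain f where f: "f \<in> ?P" "row_point s i \<in> f"
      using cov by blast
    then have "f \<in> M"
      using sub by blast
    then show "e \<in> ?P"
      using pairing_eq_if_common[OF e _ si(1) f(2)] f by simp
  qed
qed

end

lemma num_pairings_eq_card_domino_pairs: "num_pairings n n = card (domino_pairs n)"
proof -
  have "bij_betw (\<lambda>M. (left_ends 0 M, left_ends 1 M)) (pairings n) (domino_pairs n)"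
  proof (rule bij_betw_byWitness[where f' = "\<lambda>(B, T). domino_pairing n B T"])
    show "(\<lambda>M. (left_ends 0 M, left_ends 1 M)) ` pairings n \<subseteq> domino_pairs n"
      using left_ends_in_domino_pairs by auto
    show "(\<lambda>(B, T). domino_pairing n B T) ` domino_pairs n \<subseteq> pairings n"
      using domino_pairing_in_pairings by auto
  qed (auto simp: domino_pairing_left_ends left_ends_domino_pairing)
  then show ?thesis by (simp add: bij_betw_same_card num_pairings_def pairings_def)
qed

subsection \<open>Chords of a circle\<close>

text \<open>A chord between the angles \<open>s\<close> and \<open>t\<close> lies on a level line of \<open>side c ((s + t) / 2)\<close>.\<close>

definition side :: "complex \<Rightarrow> real \<Rightarrow> complex \<Rightarrow> real" where
  "side c m z = Re ((z - c) * cis (- m))"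

lemma side_circle_point: "side c m (circle_point c r t) = r * cos (t - m)"
proof -
  have "(circle_point c r t - c) * cis (- m) = of_real r * cis (t - m)"
    by (simp add: circle_point_def cis_mult)
  then show ?thesis by (simp add: side_def)
qed

lemma side_affine: "side c m ((1 - u) *\<^sub>R a + u *\<^sub>R b) = (1 - u) * side c m a + u * side c m b"
proof -
  have "((1 - u) *\<^sub>R a + u *\<^sub>R b - c) * cis (- m) =
    (1 - u) *\<^sub>R ((a - c) * cis (- m)) + u *\<^sub>R ((b - c) * cis (- m))"
    by (simp add: algebra_simps)
  then show ?thesis by (simp add: side_def)
qed

lemma cos_less_inside:
  assumes "s < u" "u < t" "t < s + 2 * pi"
  shows "cos ((t - s) / 2) < cos (u - (s + t) / 2)"
proof -
  have "cos ((t - s) / 2) < cos \<bar>u - (s + t) / 2\<bar>"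
  proof (rule cos_monotone_0_pi)
    show "\<bar>u - (s + t) / 2\<bar> < (t - s) / 2" using assms by (auto simp: abs_if field_simps)
  qed (use assms in auto)
  then show ?thesis by simp
qed

text \<open>This is \<open>cos_less_inside\<close> for the complementary arc from \<open>t\<close>
  to \<open>s + 2 * pi\<close>. Its midpoint is opposite, so both cosines change sign.\<close>

lemma cos_less_outside:
  assumes "s < t" "t < w" "w < s + 2 * pi"
  shows "cos (w - (s + t) / 2) < cos ((t - s) / 2)"
proof -
  have "cos ((s + 2 * pi - t) / 2) < cos (w - (t + (s + 2 * pi)) / 2)"
    using assms by (intro cos_less_inside) auto
  moreover have "(s + 2 * pi - t) / 2 = pi - (t - s) / 2"
    "w - (t + (s + 2 * pi)) / 2 = (w - (s + t) / 2) - pi" by (simp_all add: field_simps)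
  ultimately show ?thesis by simp
qed

text \<open>The line through the first chord has the second chord strictly on one side.\<close>

lemma chords_disjoint:
  assumes "r > 0" "s < u" "u < t" "s < u'" "u' < t" "t < s + 2 * pi"
  shows "convex hull {circle_point c r s, circle_point c r t} \<inter>
    convex hull {circle_point c r u, circle_point c r u'} = {}"
proof -
  define m where "m = (s + t) / 2"
  define X where "X = r * cos ((t - s) / 2)"
  have "s - m = - ((t - s) / 2)" "t - m = (t - s) / 2" by (auto simp: m_def field_simps)
  then have st: "side c m (circle_point c r s) = X" "side c m (circle_point c r t) = X"
    by (simp_all only: side_circle_point X_def cos_minus)
  have "side c m z = X" if z: "z \<in> convex hull {circle_point c r s, circle_point c r t}" for z
  proof -
    obtain a where "z = (1 - a) *\<^sub>R circle_point c r s + a *\<^sub>R circle_point c r t"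
      using z by (auto simp: segment_convex_hull[symmetric] in_segment)
    then show ?thesis by (simp only: side_affine st) (simp add: algebra_simps)
  qed
  moreover have "X < side c m z" if z: "z \<in> convex hull {circle_point c r u, circle_point c r u'}" for z
  proof -
    obtain a where a: "0 \<le> a" "a \<le> 1" "z = (1 - a) *\<^sub>R circle_point c r u + a *\<^sub>R circle_point c r u'"
      using z by (auto simp: segment_convex_hull[symmetric] in_segment)
    have "X < side c m (circle_point c r u)" "X < side c m (circle_point c r u')"
      using cos_less_inside[of s u t] cos_less_inside[of s u' t] assms
      by (simp_all add: side_circle_point X_def m_def)
    then have "X < (1 - a) * side c m (circle_point c r u) + a * side c m (circle_point c r u')"
      using a convex_bound_lt[of "- side c m (circle_point c r u)" "- X" "- side c m (circle_point c r u')" "1 - a" a]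
      by simp
    then show ?thesis by (simp only: a(3) side_affine)
  qed
  ultimately show ?thesis by fastforce
qed

text \<open>The disc meets the line of a chord in that chord only. Turning by \<open>- m\<close>
  makes the chord vertical with half-length \<open>k\<close>, and Pythagoras bounds the imaginary
  part of \<open>q\<close> by \<open>k\<close>.\<close>

lemma in_chord_if_side_eq:
  assumes "r > 0" "s < t" "t < s + 2 * pi" "norm (z - c) \<le> r"
    and "side c ((s + t) / 2) z = r * cos ((t - s) / 2)"
  shows "z \<in> convex hull {circle_point c r s, circle_point c r t}"
proof -
  define m h where "m = (s + t) / 2" and "h = (t - s) / 2"
  define q where "q = (z - c) * cis (- m)"
  define k where "k = r * sin h"
  have "0 < h" "h < pi" using assms by (auto simp: h_def)
  then have k: "k > 0" using assms(1) by (simp add: k_def sin_gt_zero)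
  have re: "Re q = r * cos h" using assms(5) by (simp add: q_def side_def m_def h_def)
  have "norm q \<le> r" using assms(4) by (simp add: q_def norm_mult)
  then have "(norm q)\<^sup>2 \<le> r\<^sup>2" by (simp add: power_mono)
  then have "(r * cos h)\<^sup>2 + (Im q)\<^sup>2 \<le> r\<^sup>2" by (simp add: cmod_power2 re)
  moreover have "r\<^sup>2 = (r * cos h)\<^sup>2 + k\<^sup>2"
  proof -
    have "(r * cos h)\<^sup>2 + k\<^sup>2 = r\<^sup>2 * ((cos h)\<^sup>2 + (sin h)\<^sup>2)"
      by (simp only: k_def power_mult_distrib distrib_left)
    then show ?thesis by simp
  qed
  ultimately have "(Im q)\<^sup>2 \<le> k\<^sup>2" by simp
  then have im: "\<bar>Im q\<bar> \<le> k" using k by (simp add: abs_le_square_iff[symmetric])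
  \<comment> \<open>The linear parameter that is 0 at imaginary part \<open>- k\<close>, the end at
    angle \<open>s\<close>, and 1 at \<open>k\<close>, the end at angle \<open>t\<close>.\<close>
  define a where "a = (k + Im q) / (2 * k)"
  have a: "0 \<le> a" "a \<le> 1" using im k by (auto simp: a_def field_simps)
  have ak: "2 * a * k = k + Im q" using k by (simp add: a_def)
  have "q = (1 - a) *\<^sub>R (of_real r * cis (- h)) + a *\<^sub>R (of_real r * cis h)"
    using re ak by (simp add: complex_eq_iff k_def algebra_simps)
  then have "q * cis m = (1 - a) *\<^sub>R (of_real r * (cis (- h) * cis m)) + a *\<^sub>R (of_real r * (cis h * cis m))"
    by (simp only: distrib_right mult_scaleR_left mult.assoc)
  moreover have "q * cis m = z - c" by (simp add: q_def mult.assoc cis_mult)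
  moreover have "cis (- h) * cis m = cis s" "cis h * cis m = cis t"
    by (simp_all add: cis_mult m_def h_def field_simps)
  ultimately have "z - c = (1 - a) *\<^sub>R (of_real r * cis s) + a *\<^sub>R (of_real r * cis t)" by simp
  then have "z = (1 - a) *\<^sub>R circle_point c r s + a *\<^sub>R circle_point c r t"
    by (simp add: circle_point_def algebra_simps)
  then show ?thesis using a by (auto simp: segment_convex_hull[symmetric] in_segment)
qed

text \<open>The points at \<open>u\<close> and \<open>w\<close> lie on opposite sides of the line
  through the first chord. Their chord meets that line at a point of the disc, hence on the first
  chord.\<close>

lemma chords_meet:
  assumes "r > 0" "s < u" "u < t" "t < w" "w < s + 2 * pi"
  shows "convex hull {circle_point c r s, circle_point c r t} \<inter>
    convex hull {circle_point c r u, circle_point c r w} \<noteq> {}"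
proof -
  define m where "m = (s + t) / 2"
  define X where "X = r * cos ((t - s) / 2)"
  define A where "A = side c m (circle_point c r u)"
  define B where "B = side c m (circle_point c r w)"
  have AB: "X < A" "B < X"
    using cos_less_inside[of s u t] cos_less_outside[of s t w] assms
    by (simp_all add: A_def B_def side_circle_point X_def m_def)
  define a where "a = (A - X) / (A - B)"
  have a: "0 \<le> a" "a \<le> 1" using AB by (auto simp: a_def field_simps)
  define z where "z = (1 - a) *\<^sub>R circle_point c r u + a *\<^sub>R circle_point c r w"
  have zh: "z \<in> convex hull {circle_point c r u, circle_point c r w}"
    using a by (auto simp: z_def segment_convex_hull[symmetric] in_segment)
  have "a * (A - B) = A - X" using AB by (simp add: a_def)
  then have "(1 - a) * A + a * B = X" by (simp add: algebra_simps)
  then have "side c m z = X" by (simp only: z_def side_affine A_def B_def)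
  moreover have "z \<in> cball c r"
  proof -
    have "convex hull {circle_point c r u, circle_point c r w} \<subseteq> cball c r"
      using assms(1) by (intro hull_minimal) (auto simp: circle_point_def dist_norm norm_mult)
    then show ?thesis using zh by blast
  qed
  ultimately have "z \<in> convex hull {circle_point c r s, circle_point c r t}"
    using assms by (intro in_chord_if_side_eq) (auto simp: dist_norm norm_minus_commute m_def X_def)
  then show ?thesis using zh by blast
qed

lemma circle_point_eq_iff:
  assumes "r \<noteq> 0"
  shows "circle_point c r s = circle_point c r t \<longleftrightarrow> (\<exists>k::int. s = t + 2 * pi * k)"
  using assms sin_cos_eq_iff[of s t] by (auto simp: circle_point_def complex_eq_iff)

section \<open>Integer labels for the vertices of a divided circle\<close>

locale divided_circle =
  fixes l n :: nat and c :: complex and r \<phi> \<theta> :: real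
  assumes l: "l > 2" and n: "n \<ge> 1" and r: "r > 0"
    and ends: "\<And>j. j < l \<Longrightarrow> arc_endpoint c r \<theta> l j \<notin> vertices c r \<phi> (l * n)"
begin

definition m :: int where "m = int (l * n)"

text \<open>The real index at which the vertex angle \<open>\<phi> + 2 * pi * k / m\<close> would
  equal \<open>\<theta>\<close>. Its ceiling is the index of the first vertex at or after the start
  of arc 0.\<close>

definition offset :: real where "offset = (\<theta> - \<phi>) * real_of_int m / (2 * pi)"

definition angle :: "int \<Rightarrow> real" where
  "angle x = \<phi> + 2 * pi * real_of_int (\<lceil>offset\<rceil> + x) / real_of_int m"

text \<open>The vertices are numbered by all integers, starting with the first one on the arc of index 0.\<close>

definition v :: "int \<Rightarrow> complex" where "v x = circle_point c r (angle x)"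

lemma m_bounds: "m > 0" "2 * int n < m" "int n > 0" "m = int l * int n"
proof -
  have "2 * n < l * n" using l n by simp
  then show "2 * int n < m" unfolding m_def by linarith
qed (use l n in \<open>auto simp: m_def\<close>)

lemma v_eq_iff: "v x = v y \<longleftrightarrow> (\<exists>k. x = y + k * m)"
proof -
  have "angle x = angle y + 2 * pi * real_of_int k \<longleftrightarrow> x = y + k * m" for k
  proof -
    have "angle x = angle y + 2 * pi * real_of_int k \<longleftrightarrow>
        2 * pi * (real_of_int x - real_of_int y - real_of_int k * real_of_int m) = 0"
      using m_bounds(1) by (auto simp: angle_def field_simps)
    also have "\<dots> \<longleftrightarrow> real_of_int x = real_of_int (y + k * m)" by (simp, linarith)
    finally show ?thesis by (simp only: of_int_eq_iff)
  qed
  then show ?thesis using r by (auto simp: v_def circle_point_eq_iff)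
qed

lemma v_shift: "v (x + k * m) = v x"
  using v_eq_iff by blast

lemma v_neq:
  assumes "x < y" "y < x + m"
  shows "v x \<noteq> v y"
proof
  assume "v x = v y"
  then obtain k where k: "y = x + k * m" using v_eq_iff[of y x] by metis
  then have "0 < k * m" "k * m < 1 * m" using assms by auto
  then have "0 < k" "k < 1" using m_bounds(1) by (auto simp: zero_less_mult_iff)
  then show False by simp
qed

lemma angle_less: "x < y \<Longrightarrow> angle x < angle y"
  using m_bounds(1) by (auto simp: angle_def divide_strict_right_mono)

lemma angle_period: "angle (x + m) = angle x + 2 * pi"
  using m_bounds(1) by (simp add: angle_def field_simps)

lemma v_chords_disjoint:
  assumes "x < x'" "x' < y" "x < y'" "y' < y" "y < x + m"
  shows "convex hull {v x, v y} \<inter> convex hull {v x', v y'} = {}"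
  unfolding v_def
  using assms angle_less[of y "x + m"] r by (intro chords_disjoint) (auto simp: angle_less angle_period)

lemma v_chords_meet:
  assumes "x < x'" "x' < y" "y < y'" "y' < x + m"
  shows "convex hull {v x, v y} \<inter> convex hull {v x', v y'} \<noteq> {}"
  unfolding v_def
  using assms angle_less[of y' "x + m"] r by (intro chords_meet) (auto simp: angle_less angle_period)

text \<open>If the endpoints matched in swapped order, the two spans would add up to a positive
  multiple of \<open>m\<close>, but together they are below \<open>2 * n < m\<close>. In the same
  order, the two shifts agree because the spans differ by less than \<open>m\<close>.\<close>

lemma chord_eq_imp:
  assumes "{v x, v y} = {v a, v b}" "x < y" "y < x + int n" "a < b" "b < a + int n"
  shows "\<exists>k. x = a + k * m \<and> y = b + k * m"
proof -
  consider "v x = v a" "v y = v b" | "v x = v b" "v y = v a"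
    using assms(1) by (auto simp: doubleton_eq_iff)
  then show ?thesis
  proof cases
    case 1
    then obtain k k' where k: "x = a + k * m" "y = b + k' * m" using v_eq_iff by metis
    have "\<not> k < k'" "\<not> k' < k"
    proof -
      have *: "i * m + m \<le> j * m" if "i < j" for i j
        using that m_bounds(1) mult_right_mono[of "i + 1" j m] by (simp add: algebra_simps)
      show "\<not> k < k'" "\<not> k' < k"
        using *[of k k'] *[of k' k] k assms m_bounds by linarith+
    qed
    then show ?thesis using k by auto
  next
    case 2
    then obtain k k' where k: "x = b + k * m" "y = a + k' * m" using v_eq_iff by metis
    then have "(k' - k) * m = (y - x) + (b - a)" by (simp add: algebra_simps)
    then have "0 < (k' - k) * m" "(k' - k) * m < 1 * m"
      using assms(2-5) m_bounds(2) by linarith+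
    then have "0 < k' - k" "k' - k < 1" using m_bounds(1) by (auto simp: zero_less_mult_iff)
    then show ?thesis by simp
  qed
qed

lemma vertex_eq_v: "vertex c r \<phi> (l * n) k = v (int k - \<lceil>offset\<rceil>)"
  by (simp add: vertex_def v_def angle_def m_def)

lemma vertices_eq: "vertices c r \<phi> (l * n) = range v"
proof
  show "vertices c r \<phi> (l * n) \<subseteq> range v" by (auto simp: vertices_def vertex_eq_v)
  show "range v \<subseteq> vertices c r \<phi> (l * n)"
  proof clarify
    fix x
    define k where "k = nat ((\<lceil>offset\<rceil> + x) mod m)"
    have k: "int k = (\<lceil>offset\<rceil> + x) mod m" "k < l * n"
      using m_bounds(1) by (auto simp: k_def nat_less_iff m_def)
    have "int k - \<lceil>offset\<rceil> = x + (- ((\<lceil>offset\<rceil> + x) div m)) * m"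
      using k(1) by (simp add: minus_div_mult_eq_mod[symmetric])
    then have "vertex c r \<phi> (l * n) k = v x"
      unfolding vertex_eq_v by (simp only: v_shift)
    then show "v x \<in> vertices c r \<phi> (l * n)" using k(2) by (metis vertices_def imageI lessThan_iff)
  qed
qed

lemma neighbouring_eq: "neighbouring c r \<phi> (l * n) e \<longleftrightarrow> (\<exists>x. e = {v x, v (x + 1)})"
proof
  assume "neighbouring c r \<phi> (l * n) e"
  then obtain k where "e = {v (int k - \<lceil>offset\<rceil>), v (int (Suc k) - \<lceil>offset\<rceil>)}"
    by (auto simp: neighbouring_def vertex_eq_v)
  then have "e = {v (int k - \<lceil>offset\<rceil>), v ((int k - \<lceil>offset\<rceil>) + 1)}" by (simp add: algebra_simps)
  then show "\<exists>x. e = {v x, v (x + 1)}" by blast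
next
  assume "\<exists>x. e = {v x, v (x + 1)}"
  then obtain x where e: "e = {v x, v (x + 1)}" by blast
  define k where "k = nat ((\<lceil>offset\<rceil> + x) mod m)"
  have k: "int k = (\<lceil>offset\<rceil> + x) mod m" "k < l * n"
    using m_bounds(1) by (auto simp: k_def nat_less_iff m_def)
  define d where "d = - ((\<lceil>offset\<rceil> + x) div m)"
  have "int k - \<lceil>offset\<rceil> = x + d * m" "int (Suc k) - \<lceil>offset\<rceil> = (x + 1) + d * m"
    using k(1) by (simp_all add: minus_div_mult_eq_mod[symmetric] d_def)
  then have "e = {vertex c r \<phi> (l * n) k, vertex c r \<phi> (l * n) (Suc k)}"
    unfolding vertex_eq_v e by (simp only: v_shift)
  then show "neighbouring c r \<phi> (l * n) e" using k(2) by (auto simp: neighbouring_def)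
qed

lemma rotation_v: "rotation c (2 * pi / real l) (v x) = v (x + int n)"
proof -
  have "angle (x + int n) = 2 * pi / real l + angle x"
    using l n by (simp add: angle_def m_def field_simps)
  then show ?thesis
    by (simp add: rotation_def v_def circle_point_def cis_mult[symmetric])
qed

text \<open>An integral \<open>offset\<close> would put a vertex at angle \<open>\<theta>\<close>,
  an endpoint of arc 0.\<close>

lemma offset_not_int: "real_of_int k \<noteq> offset"
proof
  assume k: "real_of_int k = offset"
  have "2 * pi * offset / real_of_int m = \<theta> - \<phi>"
    using m_bounds(1) by (simp add: offset_def)
  then have "angle 0 = \<theta>" using k[symmetric] by (simp add: angle_def)
  then have "arc_endpoint c r \<theta> l 0 = v 0" by (simp add: arc_endpoint_def v_def)
  then show False using ends[of 0] l vertices_eq by auto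
qed

text \<open>Measured in steps of \<open>2 * pi / m\<close> from \<open>\<theta>\<close>, arc
  \<open>j\<close> is the interval from \<open>j * n\<close> to \<open>(j + 1) * n\<close>. The
  integer \<open>k\<close> accounts for the other angles of the same point.\<close>

lemma v_in_arc_iff:
  assumes "j < l"
  shows "v x \<in> circle_arc c r \<theta> l j \<longleftrightarrow> (x div int n) mod int l = int j"
proof -
  have "v x \<in> circle_arc c r \<theta> l j \<longleftrightarrow>
      (\<exists>k::int. \<theta> + 2 * pi * real j / real l \<le> angle (x + k * m) \<and>
        angle (x + k * m) \<le> \<theta> + 2 * pi * real (Suc j) / real l)" (is "?L \<longleftrightarrow> (\<exists>k. ?Q k)")
  proof
    assume ?L
    then obtain t where t: "circle_point c r t = v x" "\<theta> + 2 * pi * real j / real l \<le> t"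
      "t \<le> \<theta> + 2 * pi * real (Suc j) / real l"
      by (auto simp: circle_arc_def)
    then obtain k :: int where "t = angle x + 2 * pi * k"
      using r by (auto simp: v_def circle_point_eq_iff)
    also have "\<dots> = angle (x + k * m)" using m_bounds(1) by (simp add: angle_def field_simps)
    finally show "\<exists>k. ?Q k" using t by auto
  next
    assume "\<exists>k. ?Q k"
    then obtain k where "?Q k" ..
    then have "v (x + k * m) \<in> circle_arc c r \<theta> l j" by (auto simp: circle_arc_def v_def)
    then show ?L by (simp add: v_shift)
  qed
  also have "\<dots> \<longleftrightarrow> (\<exists>k. x div int n + k * int l = int j)"
  proof (intro ex_cong1)
    fix k
    define y where "y = x + k * m"
    define M where "M = real_of_int m"
    have M: "M > 0" "M = real l * real n" using m_bounds by (auto simp: M_def)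
    have ang: "angle y = \<theta> + 2 * pi / M * (real_of_int (\<lceil>offset\<rceil> + y) - offset)"
      using M(1) by (simp add: angle_def offset_def M_def field_simps)
    have J: "\<theta> + 2 * pi * real i / real l = \<theta> + 2 * pi / M * (real i * real n)" for i
      using n l by (simp add: M(2))
    have mono: "\<theta> + 2 * pi / M * a \<le> \<theta> + 2 * pi / M * b \<longleftrightarrow> a \<le> b" for a b
      using M(1) by (simp add: divide_le_cancel)
    have "?Q k \<longleftrightarrow> real j * real n \<le> real_of_int (\<lceil>offset\<rceil> + y) - offset \<and>
        real_of_int (\<lceil>offset\<rceil> + y) - offset \<le> real (Suc j) * real n"
      unfolding y_def[symmetric] J ang mono ..
    also have "\<dots> \<longleftrightarrow> int j * int n \<le> y \<and> y < int (Suc j) * int n"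
    proof -
      \<comment> \<open>Labels are displaced from true positions by a number strictly between 0 and
        1. This turns the closed real interval into a half-open integer one.\<close>
      have o: "offset < real_of_int \<lceil>offset\<rceil>" "real_of_int \<lceil>offset\<rceil> - 1 < offset"
        using offset_not_int[of "\<lceil>offset\<rceil>"] by linarith+
      have "real j * real n = real_of_int (int j * int n)"
        "real (Suc j) * real n = real_of_int (int (Suc j) * int n)" by simp_all
      then show ?thesis using o by (simp only:) linarith
    qed
    also have "\<dots> \<longleftrightarrow> y div int n = int j"
    proof
      assume "int j * int n \<le> y \<and> y < int (Suc j) * int n"
      then show "y div int n = int j"
        by (intro int_div_pos_eq[where r = "y - int j * int n"]) (auto simp: algebra_simps)
    next
      assume "y div int n = int j"
      then have "y = int j * int n + y mod int n" by (metis div_mult_mod_eq)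
      moreover have "0 \<le> y mod int n" "y mod int n < int n" using m_bounds(3) by auto
      ultimately show "int j * int n \<le> y \<and> y < int (Suc j) * int n" by (auto simp: algebra_simps)
    qed
    also have "y div int n = x div int n + k * int l"
      using m_bounds(3) by (simp add: y_def m_bounds(4) mult.assoc[symmetric])
    finally show "?Q k \<longleftrightarrow> x div int n + k * int l = int j" .
  qed
  also have "\<dots> \<longleftrightarrow> (x div int n) mod int l = int j"
  proof
    assume "\<exists>k. x div int n + k * int l = int j"
    then obtain k where "x div int n + k * int l = int j" ..
    then have "(x div int n) mod int l = int j mod int l" by (metis mod_mult_self1)
    then show "(x div int n) mod int l = int j" using assms by simp
  next
    assume "(x div int n) mod int l = int j"
    then have "x div int n + (- (x div int n div int l)) * int l = int j"
      by (simp add: minus_div_mult_eq_mod)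
    then show "\<exists>k. x div int n + k * int l = int j" ..
  qed
  finally show ?thesis .
qed

text \<open>The block number \<open>x div n\<close> changes exactly after residue
  \<open>n - 1\<close>, and consecutive block numbers differ modulo \<open>l\<close>.\<close>

lemma same_arc_iff: "(\<exists>j<l. {v x, v (x + 1)} \<subseteq> circle_arc c r \<theta> l j) \<longleftrightarrow> x mod int n \<noteq> int n - 1"
proof -
  define q where "q = x div int n"
  have bnd: "0 \<le> x mod int n" "x mod int n < int n" using m_bounds(3) by auto
  have x: "x = q * int n + x mod int n" by (simp add: q_def)
  have "(\<exists>j<l. {v x, v (x + 1)} \<subseteq> circle_arc c r \<theta> l j) \<longleftrightarrow>
      q mod int l = ((x + 1) div int n) mod int l"
  proof
    assume "\<exists>j<l. {v x, v (x + 1)} \<subseteq> circle_arc c r \<theta> l j"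
    then show "q mod int l = ((x + 1) div int n) mod int l" by (auto simp: v_in_arc_iff q_def)
  next
    assume q: "q mod int l = ((x + 1) div int n) mod int l"
    define j where "j = nat (q mod int l)"
    have "j < l" "int j = q mod int l" using l by (auto simp: j_def nat_less_iff)
    then show "\<exists>j<l. {v x, v (x + 1)} \<subseteq> circle_arc c r \<theta> l j"
      using q by (intro exI[of _ j]) (simp add: v_in_arc_iff q_def)
  qed
  also have "\<dots> \<longleftrightarrow> x mod int n \<noteq> int n - 1"
  proof (cases "x mod int n = int n - 1")
    case True
    then have "x + 1 = (q + 1) * int n" using x by (simp add: algebra_simps)
    then have "(x + 1) div int n = q + 1" using m_bounds(3) by simp
    moreover have "q mod int l \<noteq> (q + 1) mod int l"
    proof
      assume "q mod int l = (q + 1) mod int l"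
      then have "int l dvd (q + 1) - q" by (metis mod_eq_dvd_iff)
      then show False using l by (simp add: zdvd_not_zless)
    qed
    ultimately show ?thesis using True by simp
  next
    case False
    then have "(x + 1) div int n = q"
      using x bnd by (intro int_div_pos_eq[where r = "x mod int n + 1"]) (auto simp: algebra_simps)
    then show ?thesis using False by simp
  qed
  finally show ?thesis .
qed

section \<open>Periodic arc systems and chord configurations\<close>

definition chords :: "(int \<times> int) set \<Rightarrow> complex set set" where
  "chords A = (\<lambda>(x, y). {v x, v y}) ` A"

text \<open>A chord can be lifted along either side of the circle. The bound \<open>n\<close> keeps
  the short side, together with all its translates by full turns.\<close>

definition short_arcs :: "complex set set \<Rightarrow> (int \<times> int) set" where
  "short_arcs M = {(x, y). x < y \<and> y < x + int n \<and> {v x, v y} \<in> M}"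

lemma chordsI: "(x, y) \<in> A \<Longrightarrow> {v x, v y} \<in> chords A"
  unfolding chords_def by (rule image_eqI[where x = "(x, y)"]) simp_all

lemma chordsE:
  assumes "e \<in> chords A"
  obtains x y where "(x, y) \<in> A" "e = {v x, v y}"
  using assms unfolding chords_def by auto

lemma rotation_chord: "rotation c (2 * pi / real l) ` {v x, v y} = {v (x + int n), v (y + int n)}"
  by (simp add: rotation_v)

lemma inj_rotation: "inj (rotation c t)"
  by (rule injI) (simp add: rotation_def)

text \<open>Two comparisons suffice: with \<open>(x, y)\<close> and with its translate by a full
  turn. The second arc is nested in the first, lies in the gap before the translate, or encloses the
  translate.\<close>

lemma arc_cases_one_turn:
  assumes A: "A \<in> arc_systems (int n)" and xy: "(x, y) \<in> A" and xy': "(x', y') \<in> A"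
    and "x < x'" "x' < x + m"
  shows "x' < y \<and> y' < y \<or> y < x' \<and> (y' < x + m \<or> y + m < y')"
proof -
  have turn: "(x + m, y + m) \<in> A" using arc_shift[OF A, of x "int l" y] xy by (simp add: m_bounds(4))
  have less: "x < y" "x' < y'" using arc_less[OF A] xy xy' by auto
  consider "x' \<le> y" | "y < x'" by linarith
  then show ?thesis
  proof cases
    case 1
    then have "y' < y" using arc_nested[OF A xy xy'] assms(4) by (cases "y \<le> y'") auto
    then show ?thesis using less by simp
  next
    case 2
    have "\<not> (x + m \<le> y' \<and> y' \<le> y + m)"
    proof
      assume "x + m \<le> y' \<and> y' \<le> y + m"
      then have "x' = x + m" using arc_nested[OF A xy' turn] assms(5) by simp
      then show False using assms(5) by simp
    qed
    then show ?thesis using 2 by linarith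
  qed
qed

lemma chords_disjoint_or_eq:
  assumes A: "A \<in> arc_systems (int n)" and xy: "(x, y) \<in> A" and ab: "(a, b) \<in> A"
    and ne: "{v x, v y} \<noteq> {v a, v b}"
  shows "convex hull {v x, v y} \<inter> convex hull {v a, v b} = {}"
proof -
  \<comment> \<open>Moves the second arc by full turns until its left end is among the
    \<open>m\<close> integers from \<open>x\<close> on.\<close>
  define k where "k = - ((a - x) div m)"
  define x' y' where "x' = a + k * m" and "y' = b + k * m"
  have x': "x' = x + (a - x) mod m" by (simp add: x'_def k_def minus_div_mult_eq_mod[symmetric])
  have "(a + (k * int l) * int n, b + (k * int l) * int n) \<in> A" using arc_shift[OF A] ab by blast
  then have xy': "(x', y') \<in> A" by (simp add: x'_def y'_def m_bounds(4) mult.assoc)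
  have v': "v a = v x'" "v b = v y'" by (simp_all add: x'_def y'_def v_shift)
  have "0 \<le> (a - x) mod m" "(a - x) mod m < m" using m_bounds(1) by auto
  moreover have "x' \<noteq> x"
  proof
    assume "x' = x"
    moreover from this have "y = y'" using arc_left_unique[OF A xy, of y'] xy' by blast
    ultimately show False using ne v' by simp
  qed
  ultimately have "x < x'" "x' < x + m" using x' by auto
  then have cases: "x' < y \<and> y' < y \<or> y < x' \<and> (y' < x + m \<or> y + m < y')"
    using arc_cases_one_turn[OF A xy xy'] by blast
  have less: "x < y" "x' < y'" "y < x + m" "y' < x' + m"
    using arc_less[OF A xy] arc_less[OF A xy'] arc_short[OF A xy] arc_short[OF A xy'] m_bounds(2,3)
    by simp_all
  have vm: "v (z + m) = v z" for z using v_shift[of z 1] by simp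
  \<comment> \<open>The chord playing the outer role changes: the first chord, the first chord seen
    from its complementary side from \<open>y\<close> to \<open>x + m\<close>, or the second
    chord.\<close>
  consider "x' < y" "y' < y" | "y < x'" "y' < x + m" | "y < x'" "y + m < y'" using cases by blast
  then have "convex hull {v x, v y} \<inter> convex hull {v x', v y'} = {}"
  proof cases
    case 1
    then show ?thesis using v_chords_disjoint[of x x' y y'] \<open>x < x'\<close> less by simp
  next
    case 2
    then have "convex hull {v y, v (x + m)} \<inter> convex hull {v x', v y'} = {}"
      using less \<open>x' < x + m\<close> by (intro v_chords_disjoint) auto
    then show ?thesis by (simp add: vm insert_commute)
  next
    case 3
    then have "convex hull {v x', v y'} \<inter> convex hull {v (x + m), v (y + m)} = {}"
      using less \<open>x' < x + m\<close> by (intro v_chords_disjoint) auto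
    then show ?thesis by (simp add: vm Int_commute)
  qed
  then show ?thesis by (simp add: v')
qed

lemma chords_in_configurations:
  assumes "A \<in> split_arcs (int n)"
  shows "chords A \<in> chord_configurations c r \<phi> \<theta> l n"
proof -
  have A: "A \<in> arc_systems (int n)" using assms by (simp add: split_arcs_def)
  have less: "x < y" "y < x + int n" if "(x, y) \<in> A" for x y
    using that arc_less[OF A] arc_short[OF A] m_bounds(3) by auto
  have "e \<subseteq> vertices c r \<phi> (l * n) \<and> card e = 2" if e: "e \<in> chords A" for e
  proof -
    obtain x y where xy: "(x, y) \<in> A" "e = {v x, v y}" using e by (rule chordsE)
    have "y < x + m" using less[OF xy(1)] m_bounds(2,3) by linarith
    then have "v x \<noteq> v y" using less(1)[OF xy(1)] by (intro v_neq)
    then show ?thesis using xy by (simp add: vertices_eq)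
  qed
  moreover have "(\<lambda>e. rotation c (2 * pi / real l) ` e) ` chords A = chords A"
  proof
    show "(\<lambda>e. rotation c (2 * pi / real l) ` e) ` chords A \<subseteq> chords A"
    proof clarify
      fix e assume "e \<in> chords A"
      then obtain x y where xy: "(x, y) \<in> A" "e = {v x, v y}" by (rule chordsE)
      then have "(x + int n, y + int n) \<in> A" using arc_shift1[OF A] by blast
      then show "rotation c (2 * pi / real l) ` e \<in> chords A"
        unfolding xy(2) rotation_chord by (rule chordsI)
    qed
    show "chords A \<subseteq> (\<lambda>e. rotation c (2 * pi / real l) ` e) ` chords A"
    proof
      fix e assume "e \<in> chords A"
      then obtain x y where xy: "(x, y) \<in> A" "e = {v x, v y}" by (rule chordsE)
      then have "(x - int n, y - int n) \<in> A" using arc_shift1[OF A, of "x - int n" "y - int n"] by simp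
      then have "{v (x - int n), v (y - int n)} \<in> chords A" by (rule chordsI)
      moreover have "e = rotation c (2 * pi / real l) ` {v (x - int n), v (y - int n)}"
        unfolding xy(2) rotation_chord by simp
      ultimately show "e \<in> (\<lambda>e. rotation c (2 * pi / real l) ` e) ` chords A" by blast
    qed
  qed
  moreover have "disjoint_segments (chords A)"
    unfolding disjoint_segments_def
  proof (rule pairwiseI)
    fix e f assume ef: "e \<in> chords A" "f \<in> chords A" "e \<noteq> f"
    then obtain x y a b where "(x, y) \<in> A" "(a, b) \<in> A" "e = {v x, v y}" "f = {v a, v b}"
      by (metis chordsE)
    then show "convex hull e \<inter> convex hull f = {}" using chords_disjoint_or_eq[OF A] ef(3) by simp
  qed
  moreover have "\<not> (neighbouring c r \<phi> (l * n) e \<and> (\<exists>j<l. e \<subseteq> circle_arc c r \<theta> l j))"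
    if e: "e \<in> chords A" for e
  proof
    assume bad: "neighbouring c r \<phi> (l * n) e \<and> (\<exists>j<l. e \<subseteq> circle_arc c r \<theta> l j)"
    obtain x y where xy: "(x, y) \<in> A" "e = {v x, v y}" using e by (rule chordsE)
    obtain a where a: "e = {v a, v (a + 1)}" using bad by (auto simp: neighbouring_eq)
    have eq: "{v x, v y} = {v a, v (a + 1)}" using xy a by simp
    \<comment> \<open>Since \<open>y\<close> lies strictly between \<open>x\<close> and
      \<open>x + n\<close>, here \<open>n > 1\<close>; so the neighbour chord also has span below
      \<open>n\<close> and lifts can be compared.\<close>
    have "a + 1 < a + int n" using less[OF xy(1)] by simp
    then obtain k where "x = a + k * m" "y = a + 1 + k * m"
      using chord_eq_imp[OF eq less[OF xy(1)]] by auto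
    then have y: "y = x + 1" by simp
    then have "x mod int n = int n - 1" using assms xy(1) by (simp add: split_arcs_def)
    then show False using bad same_arc_iff[of x] xy(2) y by simp
  qed
  ultimately show ?thesis by (simp add: chord_configurations_def)
qed

lemma short_arcs_chords:
  assumes "A \<in> split_arcs (int n)"
  shows "short_arcs (chords A) = A"
proof -
  have A: "A \<in> arc_systems (int n)" using assms by (simp add: split_arcs_def)
  have less: "x < y" "y < x + int n" if "(x, y) \<in> A" for x y
    using that arc_less[OF A] arc_short[OF A] m_bounds(3) by auto
  have arc: "(x, y) \<in> A" if xy: "x < y" "y < x + int n" "{v x, v y} \<in> chords A" for x y
  proof -
    obtain a b where ab: "(a, b) \<in> A" "{v x, v y} = {v a, v b}" using xy(3) by (rule chordsE)
    obtain k where k: "x = a + k * m" "y = b + k * m"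
      using chord_eq_imp[OF ab(2) xy(1,2) less[OF ab(1)]] by blast
    have "k * m = (k * int l) * int n" by (simp add: m_bounds(4))
    then show ?thesis
      unfolding k using arc_shift[OF A, of a "k * int l" b] ab(1) by (simp only:)
  qed
  have "(x, y) \<in> short_arcs (chords A) \<longleftrightarrow> (x, y) \<in> A" for x y
  proof
    assume "(x, y) \<in> short_arcs (chords A)"
    then show "(x, y) \<in> A" using arc[of x y] by (simp add: short_arcs_def)
  next
    assume xy: "(x, y) \<in> A"
    then show "(x, y) \<in> short_arcs (chords A)"
      using less[OF xy] chordsI[OF xy] by (simp add: short_arcs_def)
  qed
  then show ?thesis by (intro set_eqI) (simp add: split_paired_all)
qed

context
  fixes M
  assumes M: "M \<in> chord_configurations c r \<phi> \<theta> l n"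
begin

lemma configuration_meet_eq:
  assumes "e \<in> M" "f \<in> M" "convex hull e \<inter> convex hull f \<noteq> {}"
  shows "e = f"
proof (rule ccontr)
  assume "e \<noteq> f"
  then show False
    using assms M by (simp add: chord_configurations_def disjoint_segments_def pairwise_def)
qed

lemma configuration_rotate: "{v (x + int n), v (y + int n)} \<in> M \<longleftrightarrow> {v x, v y} \<in> M"
proof -
  have inv: "(\<lambda>e. rotation c (2 * pi / real l) ` e) ` M = M"
    using M by (simp add: chord_configurations_def)
  have "inj (\<lambda>e. rotation c (2 * pi / real l) ` e)"
    by (rule injI) (simp only: inj_image_eq_iff[OF inj_rotation])
  then show ?thesis
    using inj_image_mem_iff[of "\<lambda>e. rotation c (2 * pi / real l) ` e" "{v x, v y}" M]
    unfolding inv rotation_chord by blast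
qed

text \<open>A chord whose shorter side contained a full period would cross its own rotated copy.\<close>

lemma configuration_chord_short:
  assumes "{v x, v y} \<in> M" "x < y" "2 * (y - x) \<le> m"
  shows "y < x + int n"
proof (rule ccontr)
  assume "\<not> y < x + int n"
  then have xy: "x + int n \<le> y" by simp
  \<comment> \<open>The place where \<open>l > 2\<close> enters: both \<open>y - x\<close> and
    \<open>n\<close> are at most half a turn, and \<open>n\<close> is strictly less. The rotated
    chord therefore ends before the turn is complete.\<close>
  have xy': "y + int n < x + m" using assms(3) m_bounds(2) by presburger
  have rot: "{v (x + int n), v (y + int n)} \<in> M" using configuration_rotate assms(1) by blast
  have "convex hull {v x, v y} \<inter> convex hull {v (x + int n), v (y + int n)} \<noteq> {}"
  proof (cases "x + int n = y")
    case True
    then have "v y \<in> convex hull {v x, v y} \<inter> convex hull {v (x + int n), v (y + int n)}"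
      by (simp add: hull_inc)
    then show ?thesis by blast
  next
    case False
    then show ?thesis using xy xy' m_bounds(3) by (intro v_chords_meet) auto
  qed
  then have "{v x, v y} = {v (x + int n), v (y + int n)}"
    using configuration_meet_eq assms(1) rot by blast
  then have "v x = v (x + int n) \<or> v x = v (y + int n)" by (auto simp: doubleton_eq_iff)
  moreover have "v x \<noteq> v (x + int n)" "v x \<noteq> v (y + int n)"
    using xy xy' assms(2) m_bounds by (intro v_neq; linarith)+
  ultimately show False by blast
qed

lemma chords_short_arcs: "chords (short_arcs M) = M"
proof
  show "chords (short_arcs M) \<subseteq> M" by (auto simp: chords_def short_arcs_def)
  show "M \<subseteq> chords (short_arcs M)"
  proof
    fix e assume e: "e \<in> M"
    then have "e \<subseteq> range v" "card e = 2" using M by (auto simp: chord_configurations_def vertices_eq)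
    then obtain a b where ab: "e = {v a, v b}" "v a \<noteq> v b" by (auto simp: card_2_iff)
    \<comment> \<open>The number of steps from \<open>a\<close> forward to the other end. If this
      exceeds half a turn, the chord is read from \<open>a + d\<close> to \<open>a + m\<close>
      instead.\<close>
    define d where "d = (b - a) mod m"
    have d0: "0 \<le> d" "d < m" using m_bounds(1) by (auto simp: d_def)
    have "a + d = b + (- ((b - a) div m)) * m" by (simp add: d_def minus_div_mult_eq_mod[symmetric])
    then have vd: "v (a + d) = v b" by (simp only: v_shift)
    then have d: "0 < d" using d0 ab(2) by (cases "d = 0") auto
    have vm: "v (a + m) = v a" using v_shift[of a 1] by simp
    have *: "e \<in> chords (short_arcs M)" if "e = {v x, v y}" "x < y" "2 * (y - x) \<le> m" for x y
    proof -
      have "(x, y) \<in> short_arcs M"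
        using configuration_chord_short[of x y] that e by (simp add: short_arcs_def)
      then show ?thesis unfolding that(1) by (rule chordsI)
    qed
    show "e \<in> chords (short_arcs M)"
    proof (cases "2 * d \<le> m")
      case True
      then show ?thesis using *[of a "a + d"] ab vd d by simp
    next
      case False
      then show ?thesis using *[of "a + d" "a + m"] ab vd vm d0 by (simp add: insert_commute)
    qed
  qed
qed

lemma short_arcs_split: "short_arcs M \<in> split_arcs (int n)"
  unfolding split_arcs_def arc_systems_def
proof (intro CollectI conjI allI impI)
  show "\<forall>(x, y)\<in>short_arcs M. x < y" by (auto simp: short_arcs_def)
  show "(x + int n, y + int n) \<in> short_arcs M \<longleftrightarrow> (x, y) \<in> short_arcs M" for x y
    using configuration_rotate[of x y] by (auto simp: short_arcs_def)
  show "x mod int n = int n - 1" if "(x, x + 1) \<in> short_arcs M" for x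
  proof -
    have "{v x, v (x + 1)} \<in> M" using that by (simp add: short_arcs_def)
    then have "\<not> (neighbouring c r \<phi> (l * n) {v x, v (x + 1)} \<and>
        (\<exists>j<l. {v x, v (x + 1)} \<subseteq> circle_arc c r \<theta> l j))"
      using M unfolding chord_configurations_def by blast
    then show ?thesis using same_arc_iff[of x] neighbouring_eq by blast
  qed
next
  fix x y x' y'
  assume a: "(x, y) \<in> short_arcs M" "(x', y') \<in> short_arcs M" "x \<le> x'" "x' \<le> y" "y \<le> y'"
  then have xy: "{v x, v y} \<in> M" "{v x', v y'} \<in> M" "x < y" "y < x + int n" "x' < y'" "y' < x' + int n"
    by (auto simp: short_arcs_def)
  have "convex hull {v x, v y} \<inter> convex hull {v x', v y'} \<noteq> {}"
  proof (cases "x = x' \<or> x' = y \<or> y = y'")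
    case True
    then obtain z where "z \<in> {v x, v y}" "z \<in> {v x', v y'}" by blast
    then show ?thesis by (meson disjoint_iff hull_inc)
  next
    case False
    \<comment> \<open>All four ends lie within one turn, as
      \<open>y' < x' + n < x + 2 * n < x + m\<close>.\<close>
    then show ?thesis using a xy m_bounds(2) by (intro v_chords_meet) auto
  qed
  then have "{v x, v y} = {v x', v y'}" using configuration_meet_eq xy by blast
  then obtain k where k: "x = x' + k * m" "y = y' + k * m" using chord_eq_imp xy by blast
  \<comment> \<open>The overlap \<open>x \<le> x' \<le> y < x + n\<close> leaves no room for a full
    turn between two lifts of the same chord, so \<open>k = 0\<close>.\<close>
  then have "(- k) * m < 1 * m" "k * m \<le> 0" using a(3,4) xy(4) m_bounds(2,3) by simp_all
  then have "- k < 1" "k \<le> 0"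
    using m_bounds(1) mult_less_cancel_right_pos[of m "- k" 1] mult_le_0_iff[of k m] by auto
  then show "x = x'" "y = y'" using k by auto
qed

end

lemma card_configurations: "card (chord_configurations c r \<phi> \<theta> l n) = card (split_arcs (int n))"
proof (rule bij_betw_same_card[OF bij_betw_byWitness[where f' = chords]])
  show "short_arcs ` chord_configurations c r \<phi> \<theta> l n \<subseteq> split_arcs (int n)"
    using short_arcs_split by blast
  show "chords ` split_arcs (int n) \<subseteq> chord_configurations c r \<phi> \<theta> l n"
    using chords_in_configurations by blast
qed (use chords_short_arcs short_arcs_chords in auto)

end

theorem theorem7:
  fixes l n :: nat and c :: complex and r \<phi> \<theta> :: real
  assumes "l > 2" and "n \<ge> 1" and "r > 0"
    and "\<And>j. j < l \<Longrightarrow> arc_endpoint c r \<theta> l j \<notin> vertices c r \<phi> (l * n)"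
  shows "card (chord_configurations c r \<phi> \<theta> l n) = num_pairings n n"
proof -
  interpret divided_circle l n c r \<phi> \<theta> by unfold_locales (use assms in auto)
  show ?thesis
    using assms(2) by (simp add: card_configurations card_split_arcs card_words
        num_pairings_eq_card_domino_pairs)
qed

end
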